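(* Let $1<p<2$ and let $\{X_{n},\,n\geqslant 1\}$ be a sequence of pairwise positively quadrant dependent random variables stochastically dominated by a random variable $X$ with $\mathbb{E}\lvert X\rvert^{p}<\infty$. If, for some $\alpha$ with $p<\alpha<2$, $$\sum_{1\leqslant i<j<\infty}\ \sum_{n=j}^{\infty} n^{-1-2/\alpha}\,G_{X_{i},X_{j}}\big(n^{1/p}\big)<\infty,$$ then $$\frac{1}{n^{1/p}}\sum_{k=1}^{n}(X_{k}-\mathbb{E} X_{k})\longrightarrow 0\quad\text{almost surely as } n\to\infty.$$
   Context: A sequence $\{X_{n},\,n\geqslant 1\}$ of random variables is pairwise positively quadrant dependent (pairwise PQD) if $\mathbb{P}\{X_{k}\leqslant x_{k},X_{j}\leqslant x_{j}\}-\mathbb{P}\{X_{k}\leqslant x_{k}\}\mathbb{P}\{X_{j}\leqslant x_{j}\}\geqslant 0$ for all reals $x_{k},x_{j}$ and all positive integers $k\neq j$. A sequence $\{X_{n},\,n\geqslant 1\}$ of random variables is stochastically dominated by a random variable $X$ if there is a constant $C>0$ such that $\sup_{n\geqslant 1}\mathbb{P}\{\lvert X_{n}\rvert>t\}\leqslant C\,\mathbb{P}\{\lvert X\rvert>t\}$ for all $t>0$. For $L>0$ let $g_{L}(t)=\max\{\min\{t,L\},-L\}$, and for random variables $X,Y$ let $$G_{X,Y}(L):=\mathrm{Cov}\big(g_{L}(X),g_{L}(Y)\big)=\int_{-L}^{L}\int_{-L}^{L}\big(\mathbb{P}\{X\leqslant u,Y\leqslant v\}-\mathbb{P}\{X\leqslant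 u\}\mathbb{P}\{Y\leqslant v\}\big)\,\mathrm{d}u\,\mathrm{d}v.$$ The outer sum in the hypothesis runs over all pairs of positive integers $i<j$. *)

theory Defs
  imports "HOL-Probability.Probability"
begin

text \<open>
  Sequences are indexed by the positive integers: the entry at index 0 of a
  function \<open>nat \<Rightarrow> _\<close> is ignored throughout. In all definitions \<open>M\<close> is
  meant to be a probability space and the functions to be random variables on it.
\<close>

definition pairwise_PQD :: "'a measure \<Rightarrow> (nat \<Rightarrow> 'a \<Rightarrow> real) \<Rightarrow> bool" where
  "pairwise_PQD M X \<longleftrightarrow>
    (\<forall>k\<ge>1. \<forall>j\<ge>1. k \<noteq> j \<longrightarrow> (\<forall>x y.
      measure M {\<omega> \<in> space M. X k \<omega> \<le> x \<and> X j \<omega> \<le> y}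
        - measure M {\<omega> \<in> space M. X k \<omega> \<le> x} * measure M {\<omega> \<in> space M. X j \<omega> \<le> y} \<ge> 0))"

text \<open>The real-valued supremum is genuine, as probabilities are bounded by 1.\<close>

definition stochastically_dominated ::
    "'a measure \<Rightarrow> (nat \<Rightarrow> 'a \<Rightarrow> real) \<Rightarrow> ('a \<Rightarrow> real) \<Rightarrow> bool" where
  "stochastically_dominated M X Y \<longleftrightarrow>
    (\<exists>C>0. \<forall>t>0. (SUP n\<in>{1..}. measure M {\<omega> \<in> space M. \<bar>X n \<omega>\<bar> > t})
                    \<le> C * measure M {\<omega> \<in> space M. \<bar>Y \<omega>\<bar> > t})"

definition covariance :: "'a measure \<Rightarrow> ('a \<Rightarrow> real) \<Rightarrow> ('a \<Rightarrow> real) \<Rightarrow> real" where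
  "covariance M X Y =
    (LINT \<omega>|M. (X \<omega> - (LINT \<omega>'|M. X \<omega>')) * (Y \<omega> - (LINT \<omega>'|M. Y \<omega>')))"

definition trunc :: "real \<Rightarrow> real \<Rightarrow> real" where
  "trunc L t = max (min t L) (- L)"

definition trunc_cov :: "'a measure \<Rightarrow> ('a \<Rightarrow> real) \<Rightarrow> ('a \<Rightarrow> real) \<Rightarrow> real \<Rightarrow> real" where
  "trunc_cov M X Y L = covariance M (\<lambda>\<omega>. trunc L (X \<omega>)) (\<lambda>\<omega>. trunc L (Y \<omega>))"

text \<open>
  The iterated series, valued in \<open>[0, \<infinity>]\<close>, is formed for sequences that are
  pairwise PQD. For these every covariance occurring in it is nonnegative (by
  Hoeffding's covariance formula), so \<open>ennreal\<close> truncates nothing.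
\<close>

definition trunc_cov_series ::
    "'a measure \<Rightarrow> (nat \<Rightarrow> 'a \<Rightarrow> real) \<Rightarrow> real \<Rightarrow> real \<Rightarrow> ennreal" where
  "trunc_cov_series M X p \<alpha> =
    (\<Sum>\<^sub>\<infinity>(i, j)\<in>{(i, j). 1 \<le> i \<and> i < j}. \<Sum>\<^sub>\<infinity>n\<in>{j..}.
       ennreal (real n powr (- 1 - 2 / \<alpha>) * trunc_cov M (X i) (X j) (real n powr (1 / p))))"

end

theory Submission
  imports Defs
begin

text \<open>
  Put \<open>r = 2 powr (1 / p)\<close>, so that \<open>1 < r < 2 < r\<^sup>2\<close>, and \<open>\<beta> = 2 powr (2 / \<alpha>)\<close>, so that
  \<open>2 < \<beta> < r\<^sup>2\<close>. It suffices to bound the centred partial sums of index below \<open>2 ^ m\<close> by \<open>r ^ m\<close>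
  times a null sequence. The moment hypothesis enters only through the dyadic tails:
  \<open>\<Sum>j. 2 ^ j * q j < \<infinity>\<close>, where \<open>q j\<close> bounds \<open>P (\<bar>X\<^sub>k\<bar> > r ^ j)\<close> for every \<open>k\<close>.

  For \<open>p > 1\<close> the usual route (control a subsequence, fill the gaps by monotonicity) loses too
  much, because the means of the positive summands grow like \<open>n\<close> and not like \<open>n powr (1 / p)\<close>.
  The proof instead uses a chaining argument in the manner of Rio, in which the truncation level
  follows the scale: on dyadic blocks of length \<open>2 ^ i\<close> the variables are truncated at \<open>r ^ i\<close>.
  Let \<open>n < 2 ^ m\<close> and let \<open>n\<^sub>i\<close> be the largest multiple of \<open>2 ^ i\<close> not exceeding \<open>n\<close>. Passing from
  level \<open>i\<close> to level \<open>i + 1\<close> changes the sum over \<open>{n\<^sub>i..<n}\<close> by one full block at level \<open>i\<close> and by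
  the layer of values between \<open>r ^ i\<close> and \<open>r ^ Suc i\<close> over part of a block at level \<open>i + 1\<close>.
  The layer is nonnegative, so the part is controlled by the full block plus a mean of size at
  most \<open>2 ^ Suc i * r ^ Suc i * q i\<close> (lemma \<open>chaining\<close>). Only full blocks remain, and these are
  controlled in mean square. With the weights \<open>rho ^ (2 * (m - i))\<close> for some \<open>rho > 1\<close>, the sum
  \<open>energy m\<close> of the squares of all block sums inside \<open>{..<2 ^ m}\<close>, divided by \<open>r ^ (2 * m)\<close>, has
  summable expectations (lemma \<open>expectation_energy_summable\<close>): the variances are summable by the tail
  condition, and the covariances contribute \<open>O (\<beta> ^ m)\<close>, which leaves geometric room below
  \<open>r ^ (2 * m)\<close>. What lies above the level \<open>r ^ m\<close> is summable in the mean
  (lemma \<open>expectation_overshoot_summable\<close>).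

  Chaining needs nonnegative variables, so it is applied to the positive and the negative parts
  (locale \<open>layered_sequence\<close>, theorem \<open>dyadic_strong_law\<close>). A layer of either part is, up to a
  reflection, a layer of \<open>X\<^sub>k\<close> itself. For PQD pairs covariances of layers are nonnegative
  (\<open>covariance_layer_nonneg\<close>), and layers are additive, so the covariance of a layer inside
  \<open>{-L..L}\<close> is at most \<open>G(L)\<close> (\<open>covariance_layer_mono\<close>). Finally the terms with
  \<open>2 ^ m \<le> n < 2 ^ (m + 1)\<close> of the given series bound the sum of \<open>G(r ^ m)\<close> over the pairs of
  indices up to \<open>2 ^ m\<close> by a constant times \<open>\<beta> ^ m\<close> (\<open>trunc_cov_sum_le\<close>).
\<close>

section \<open>Covariances of layers\<close>

text \<open>
  The part of \<open>t\<close> between the levels \<open>a\<close> and \<open>b\<close>. Subtracting \<open>a\<close> makes layers nonnegative and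
  additive over adjacent intervals.
\<close>

definition layer :: "real \<Rightarrow> real \<Rightarrow> real \<Rightarrow> real" where
  "layer a b t = max a (min b t) - a"

lemma layer_measurable [measurable]: "layer a b \<in> borel_measurable borel"
  unfolding layer_def by measurable

lemma layer_nonneg: "0 \<le> layer a b t"
  by (simp add: layer_def)

lemma layer_le: "a \<le> b \<Longrightarrow> layer a b t \<le> b - a"
  by (simp add: layer_def)

lemma layer_add: "a \<le> b \<Longrightarrow> b \<le> c \<Longrightarrow> layer a c t = layer a b t + layer b c t"
  by (auto simp: layer_def max_def min_def)

lemma layer_uminus: "a \<le> b \<Longrightarrow> layer a b (- t) = (b - a) - layer (- b) (- a) t"
  by (auto simp: layer_def max_def min_def)

lemma layer_pos_part: "0 \<le> a \<Longrightarrow> layer a b (max t 0) = layer a b t"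
  by (auto simp: layer_def max_def min_def)

lemma trunc_eq_layer: "0 \<le> L \<Longrightarrow> trunc L t = layer (- L) L t - L"
  by (auto simp: layer_def trunc_def max_def min_def)

lemma less_layer_iff: "0 \<le> u \<Longrightarrow> a \<le> b \<Longrightarrow> u < layer a b t \<longleftrightarrow> u < b - a \<and> a + u < t"
  by (auto simp: layer_def max_def min_def)

context prob_space
begin

lemma layer_integrable [simp, intro]:
  assumes "X \<in> borel_measurable M" "a \<le> b"
  shows "integrable M (\<lambda>\<omega>. layer a b (X \<omega>))"
proof (rule integrable_const_bound[where B = "b - a"])
  show "AE \<omega> in M. norm (layer a b (X \<omega>)) \<le> b - a"
    using assms by (auto simp: layer_nonneg layer_le)
qed (use assms in measurable)

lemma layer_mult_integrable [simp, intro]: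
  assumes "X \<in> borel_measurable M" "Y \<in> borel_measurable M" "a \<le> b" "c \<le> d"
  shows "integrable M (\<lambda>\<omega>. layer a b (X \<omega>) * layer c d (Y \<omega>))"
proof (rule integrable_const_bound[where B = "(b - a) * (d - c)"])
  show "AE \<omega> in M. norm (layer a b (X \<omega>) * layer c d (Y \<omega>)) \<le> (b - a) * (d - c)"
    using assms by (auto simp: layer_nonneg layer_le abs_mult intro!: mult_mono)
qed (use assms in measurable)

lemma covariance_eq:
  fixes f g :: "'a \<Rightarrow> real"
  assumes "integrable M f" "integrable M g" "integrable M (\<lambda>\<omega>. f \<omega> * g \<omega>)"
  shows "covariance M f g = expectation (\<lambda>\<omega>. f \<omega> * g \<omega>) - expectation f * expectation g"
proof -
  let ?a = "expectation f" and ?b = "expectation g"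
  have "covariance M f g = expectation (\<lambda>\<omega>. f \<omega> * g \<omega> - ?b * f \<omega> - ?a * g \<omega> + ?a * ?b)"
    unfolding covariance_def by (intro Bochner_Integration.integral_cong) (auto simp: algebra_simps)
  also have "\<dots> = expectation (\<lambda>\<omega>. f \<omega> * g \<omega>) - ?b * ?a - ?a * ?b + ?a * ?b"
    using assms by (simp add: prob_space)
  finally show ?thesis by simp
qed

lemma covariance_reflect:
  fixes f g :: "'a \<Rightarrow> real"
  assumes "integrable M f" "integrable M g"
  shows "covariance M (\<lambda>\<omega>. c - f \<omega>) (\<lambda>\<omega>. d - g \<omega>) = covariance M f g"
  unfolding covariance_def using assms
  by (intro Bochner_Integration.integral_cong) (auto simp: prob_space algebra_simps)

lemma covariance_shift:
  fixes f g :: "'a \<Rightarrow> real"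
  assumes "integrable M f" "integrable M g"
  shows "covariance M (\<lambda>\<omega>. f \<omega> - c) (\<lambda>\<omega>. g \<omega> - d) = covariance M f g"
  unfolding covariance_def using assms
  by (intro Bochner_Integration.integral_cong) (auto simp: prob_space algebra_simps)

text \<open>
  The layer-cake formula, with a weight so that it can be applied to the two factors of a product
  one after the other.
\<close>

lemma nn_integral_weighted_layer_cake:
  fixes U :: "'a \<Rightarrow> real" and W :: "'a \<Rightarrow> ennreal"
  assumes [measurable]: "U \<in> borel_measurable M" "W \<in> borel_measurable M"
    and nn: "\<And>\<omega>. 0 \<le> U \<omega>"
  shows "(\<integral>\<^sup>+\<omega>. ennreal (U \<omega>) * W \<omega> \<partial>M)
    = (\<integral>\<^sup>+u\<in>{0..}. (\<integral>\<^sup>+\<omega>. indicator {\<omega>. u < U \<omega>} \<omega> * W \<omega> \<partial>M) \<partial>lborel)"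
proof -
  interpret P: pair_sigma_finite M lborel ..
  let ?f = "\<lambda>\<omega> u. indicator {\<omega>. u < U \<omega>} \<omega> * W \<omega> * indicator {0..} u :: ennreal"
  have [measurable]: "case_prod ?f \<in> borel_measurable (M \<Otimes>\<^sub>M lborel)"
    unfolding indicator_def by measurable
  have "ennreal (U \<omega>) * W \<omega> = (\<integral>\<^sup>+u. ?f \<omega> u \<partial>lborel)" for \<omega>
  proof -
    have "(\<integral>\<^sup>+u. ?f \<omega> u \<partial>lborel) = (\<integral>\<^sup>+u. W \<omega> * indicator {0..<U \<omega>} u \<partial>lborel)"
      by (intro nn_integral_cong) (auto simp: indicator_def)
    also have "\<dots> = W \<omega> * ennreal (U \<omega>)"
      using nn[of \<omega>] by (subst nn_integral_cmult_indicator) auto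
    finally show ?thesis by (simp add: mult.commute)
  qed
  then have "(\<integral>\<^sup>+\<omega>. ennreal (U \<omega>) * W \<omega> \<partial>M) = (\<integral>\<^sup>+\<omega>. (\<integral>\<^sup>+u. ?f \<omega> u \<partial>lborel) \<partial>M)"
    by simp
  also have "\<dots> = (\<integral>\<^sup>+u. (\<integral>\<^sup>+\<omega>. ?f \<omega> u \<partial>M) \<partial>lborel)"
    by (rule P.Fubini'[symmetric]) measurable
  also have "\<dots> = (\<integral>\<^sup>+u\<in>{0..}. (\<integral>\<^sup>+\<omega>. indicator {\<omega>. u < U \<omega>} \<omega> * W \<omega> \<partial>M) \<partial>lborel)"
    by (intro nn_integral_cong) (auto simp: indicator_def)
  finally show ?thesis .
qed

text \<open>
  Hoeffding's argument: \<open>E (U V)\<close> is the integral of \<open>P (U > u, V > v)\<close> over the positive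
  quadrant, and \<open>E U * E V\<close> is that of the product of the two probabilities.
\<close>

lemma covariance_nonneg_of_upper_quadrant:
  fixes U V :: "'a \<Rightarrow> real"
  assumes [measurable]: "U \<in> borel_measurable M" "V \<in> borel_measurable M"
    and int: "integrable M U" "integrable M V" "integrable M (\<lambda>\<omega>. U \<omega> * V \<omega>)"
    and nn: "\<And>\<omega>. 0 \<le> U \<omega>" "\<And>\<omega>. 0 \<le> V \<omega>"
    and quad: "\<And>u v. 0 \<le> u \<Longrightarrow> 0 \<le> v \<Longrightarrow>
      prob {\<omega> \<in> space M. u < U \<omega>} * prob {\<omega> \<in> space M. v < V \<omega>}
        \<le> prob {\<omega> \<in> space M. u < U \<omega> \<and> v < V \<omega>}"
  shows "0 \<le> covariance M U V"
proof -
  have A: "(\<integral>\<^sup>+\<omega>. indicator {\<omega>. P \<omega>} \<omega> \<partial>M) = ennreal (prob {\<omega> \<in> space M. P \<omega>})"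
    if [measurable]: "Measurable.pred M P" for P
  proof -
    have "(\<integral>\<^sup>+\<omega>. indicator {\<omega>. P \<omega>} \<omega> \<partial>M) = (\<integral>\<^sup>+\<omega>. indicator {\<omega> \<in> space M. P \<omega>} \<omega> \<partial>M)"
      by (intro nn_integral_cong) (auto simp: indicator_def)
    also have "\<dots> = ennreal (prob {\<omega> \<in> space M. P \<omega>})"
      by (subst nn_integral_indicator) (auto simp: emeasure_eq_measure)
    finally show ?thesis .
  qed
  let ?pU = "\<lambda>u. ennreal (prob {\<omega> \<in> space M. u < U \<omega>})"
  let ?pV = "\<lambda>v. ennreal (prob {\<omega> \<in> space M. v < V \<omega>})"
  let ?pUV = "\<lambda>u v. ennreal (prob {\<omega> \<in> space M. u < U \<omega> \<and> v < V \<omega>})"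
  have EU: "(\<integral>\<^sup>+\<omega>. ennreal (U \<omega>) \<partial>M) = (\<integral>\<^sup>+u\<in>{0..}. ?pU u \<partial>lborel)"
    using nn_integral_weighted_layer_cake[of U "\<lambda>_. 1"] nn A by simp
  have EV: "(\<integral>\<^sup>+\<omega>. ennreal (V \<omega>) \<partial>M) = (\<integral>\<^sup>+v\<in>{0..}. ?pV v \<partial>lborel)"
    using nn_integral_weighted_layer_cake[of V "\<lambda>_. 1"] nn A by simp
  have EUV: "(\<integral>\<^sup>+\<omega>. ennreal (U \<omega> * V \<omega>) \<partial>M)
      = (\<integral>\<^sup>+u\<in>{0..}. (\<integral>\<^sup>+v\<in>{0..}. ?pUV u v \<partial>lborel) \<partial>lborel)"
  proof -
    have "(\<integral>\<^sup>+\<omega>. indicator {\<omega>. u < U \<omega>} \<omega> * ennreal (V \<omega>) \<partial>M) = (\<integral>\<^sup>+v\<in>{0..}. ?pUV u v \<partial>lborel)" for u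
    proof -
      have *: "indicator {\<omega>. v < V \<omega>} \<omega> * indicator {\<omega>. u < U \<omega>} \<omega>
          = (indicator {\<omega>. u < U \<omega> \<and> v < V \<omega>} \<omega> :: ennreal)" for v \<omega>
        by (auto simp: indicator_def)
      have "(\<integral>\<^sup>+\<omega>. indicator {\<omega>. u < U \<omega>} \<omega> * ennreal (V \<omega>) \<partial>M)
        = (\<integral>\<^sup>+\<omega>. ennreal (V \<omega>) * indicator {\<omega>. u < U \<omega>} \<omega> \<partial>M)"
        by (simp add: mult.commute)
      also have "\<dots> = (\<integral>\<^sup>+v\<in>{0..}. (\<integral>\<^sup>+\<omega>. indicator {\<omega>. v < V \<omega>} \<omega> * indicator {\<omega>. u < U \<omega>} \<omega> \<partial>M) \<partial>lborel)"
        by (rule nn_integral_weighted_layer_cake) (use nn in auto)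
      also have "\<dots> = (\<integral>\<^sup>+v\<in>{0..}. ?pUV u v \<partial>lborel)"
        by (subst *, subst A) auto
      finally show ?thesis .
    qed
    then show ?thesis
      using nn_integral_weighted_layer_cake[of U "\<lambda>\<omega>. ennreal (V \<omega>)"] nn by (simp add: ennreal_mult)
  qed
  have tail_measurable: "(\<lambda>x::real. prob {\<omega> \<in> space M. x < W \<omega>}) \<in> borel_measurable borel"
    if [measurable]: "W \<in> borel_measurable M" for W
  proof -
    have "mono (\<lambda>x::real. - prob {\<omega> \<in> space M. x < W \<omega>})"
      by (intro monoI) (auto intro!: finite_measure_mono)
    from borel_measurable_uminus[OF borel_measurable_mono[OF this]] show ?thesis by simp
  qed
  have [measurable]: "?pU \<in> borel_measurable lborel" "?pV \<in> borel_measurable lborel"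
    using tail_measurable[of U] tail_measurable[of V] by simp_all
  have "ennreal (expectation U * expectation V) = (\<integral>\<^sup>+\<omega>. ennreal (U \<omega>) \<partial>M) * (\<integral>\<^sup>+\<omega>. ennreal (V \<omega>) \<partial>M)"
    using int nn by (simp add: nn_integral_eq_integral ennreal_mult)
  also have "\<dots> = (\<integral>\<^sup>+u\<in>{0..}. (\<integral>\<^sup>+v\<in>{0..}. ?pU u * ?pV v \<partial>lborel) \<partial>lborel)"
  proof -
    have "(\<integral>\<^sup>+v\<in>{0..}. ?pU u * ?pV v \<partial>lborel) = ?pU u * (\<integral>\<^sup>+v\<in>{0..}. ?pV v \<partial>lborel)" for u
      by (simp add: nn_integral_cmult mult.assoc)
    then show ?thesis
      unfolding EU EV by (simp add: nn_integral_multc[symmetric] mult_ac)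
  qed
  also have "\<dots> \<le> (\<integral>\<^sup>+u\<in>{0..}. (\<integral>\<^sup>+v\<in>{0..}. ?pUV u v \<partial>lborel) \<partial>lborel)"
  proof -
    have "(\<integral>\<^sup>+v\<in>{0..}. ?pU u * ?pV v \<partial>lborel) \<le> (\<integral>\<^sup>+v\<in>{0..}. ?pUV u v \<partial>lborel)" if "0 \<le> u" for u
      using that quad
      by (intro nn_integral_mono) (auto simp: ennreal_mult[symmetric] indicator_def intro!: ennreal_leI)
    then show ?thesis
      by (intro nn_integral_mono) (auto simp: indicator_def)
  qed
  also have "\<dots> = ennreal (expectation (\<lambda>\<omega>. U \<omega> * V \<omega>))"
    unfolding EUV[symmetric] using int nn by (simp add: nn_integral_eq_integral)
  finally have "expectation U * expectation V \<le> expectation (\<lambda>\<omega>. U \<omega> * V \<omega>)"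
    using nn by (subst (asm) ennreal_le_iff) auto
  then show ?thesis
    using covariance_eq[OF int] by simp
qed

text \<open>
  By inclusion and exclusion, upper and lower quadrants give the same difference, so positive
  quadrant dependence may be read off from either.
\<close>

lemma prob_upper_quadrant:
  fixes X Y :: "'a \<Rightarrow> real"
  assumes [measurable]: "X \<in> borel_measurable M" "Y \<in> borel_measurable M"
  shows "prob {\<omega> \<in> space M. x < X \<omega> \<and> y < Y \<omega>}
      - prob {\<omega> \<in> space M. x < X \<omega>} * prob {\<omega> \<in> space M. y < Y \<omega>}
    = prob {\<omega> \<in> space M. X \<omega> \<le> x \<and> Y \<omega> \<le> y}
      - prob {\<omega> \<in> space M. X \<omega> \<le> x} * prob {\<omega> \<in> space M. Y \<omega> \<le> y}"
proof -
  let ?A = "{\<omega> \<in> space M. X \<omega> \<le> x}" and ?B = "{\<omega> \<in> space M. Y \<omega> \<le> y}"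
  have [measurable]: "?A \<in> events" "?B \<in> events" by measurable
  have "{\<omega> \<in> space M. x < X \<omega>} = space M - ?A" "{\<omega> \<in> space M. y < Y \<omega>} = space M - ?B"
    "{\<omega> \<in> space M. x < X \<omega> \<and> y < Y \<omega>} = space M - (?A \<union> ?B)"
    "{\<omega> \<in> space M. X \<omega> \<le> x \<and> Y \<omega> \<le> y} = ?A \<inter> ?B"
    by auto
  moreover have "prob (?A \<union> ?B) = prob ?A + prob ?B - prob (?A \<inter> ?B)"
    using measure_Un3[of ?A M ?B] by (simp add: fmeasurable_eq_sets)
  ultimately show ?thesis
    by (simp add: prob_compl algebra_simps)
qed

text \<open>
  A layer of \<open>X\<close> exceeds \<open>u \<ge> 0\<close> either never or exactly when \<open>X > a + u\<close>, so pairs of layers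
  inherit the quadrant inequality.
\<close>

lemma covariance_layer_nonneg:
  fixes X Y :: "'a \<Rightarrow> real"
  assumes [measurable]: "X \<in> borel_measurable M" "Y \<in> borel_measurable M"
    and pqd: "\<And>x y. prob {\<omega> \<in> space M. X \<omega> \<le> x} * prob {\<omega> \<in> space M. Y \<omega> \<le> y}
      \<le> prob {\<omega> \<in> space M. X \<omega> \<le> x \<and> Y \<omega> \<le> y}"
    and ab: "a \<le> b" and cd: "c \<le> d"
  shows "0 \<le> covariance M (\<lambda>\<omega>. layer a b (X \<omega>)) (\<lambda>\<omega>. layer c d (Y \<omega>))"
proof (rule covariance_nonneg_of_upper_quadrant)
  fix u v :: real
  assume uv: "0 \<le> u" "0 \<le> v"
  show "prob {\<omega> \<in> space M. u < layer a b (X \<omega>)} * prob {\<omega> \<in> space M. v < layer c d (Y \<omega>)}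
        \<le> prob {\<omega> \<in> space M. u < layer a b (X \<omega>) \<and> v < layer c d (Y \<omega>)}"
  proof (cases "u < b - a \<and> v < d - c")
    case True
    then show ?thesis
      using prob_upper_quadrant[of X Y "a + u" "c + v"] pqd[of "a + u" "c + v"]
      by (simp add: less_layer_iff uv ab cd)
  next
    case False
    then show ?thesis
      by (auto simp: less_layer_iff uv ab cd)
  qed
qed (use ab cd in \<open>auto simp: layer_nonneg\<close>)

lemma covariance_layer_split:
  fixes X Y :: "'a \<Rightarrow> real"
  assumes [measurable]: "X \<in> borel_measurable M" "Y \<in> borel_measurable M"
    and le: "a \<le> b" "b \<le> c" "d \<le> e"
  shows "covariance M (\<lambda>\<omega>. layer a c (X \<omega>)) (\<lambda>\<omega>. layer d e (Y \<omega>))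
      = covariance M (\<lambda>\<omega>. layer a b (X \<omega>)) (\<lambda>\<omega>. layer d e (Y \<omega>))
        + covariance M (\<lambda>\<omega>. layer b c (X \<omega>)) (\<lambda>\<omega>. layer d e (Y \<omega>))"
  using le layer_add[OF le(1,2)] by (simp add: covariance_eq distrib_right)

lemma covariance_commute: "covariance M f g = covariance M g f"
  by (simp add: covariance_def mult.commute)

text \<open>
  Widening the interval in one argument adds two further layers, whose covariances with the other
  argument are nonnegative; the two arguments are widened in turn.
\<close>

lemma covariance_layer_mono:
  fixes X Y :: "'a \<Rightarrow> real"
  assumes [measurable]: "X \<in> borel_measurable M" "Y \<in> borel_measurable M"
    and pqd: "\<And>x y. prob {\<omega> \<in> space M. X \<omega> \<le> x} * prob {\<omega> \<in> space M. Y \<omega> \<le> y}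
      \<le> prob {\<omega> \<in> space M. X \<omega> \<le> x \<and> Y \<omega> \<le> y}"
    and le: "A \<le> a" "a \<le> b" "b \<le> B"
  shows "covariance M (\<lambda>\<omega>. layer a b (X \<omega>)) (\<lambda>\<omega>. layer a b (Y \<omega>))
    \<le> covariance M (\<lambda>\<omega>. layer A B (X \<omega>)) (\<lambda>\<omega>. layer A B (Y \<omega>))"
proof -
  have widen: "covariance M (\<lambda>\<omega>. layer a b (U \<omega>)) (\<lambda>\<omega>. layer d e (V \<omega>))
      \<le> covariance M (\<lambda>\<omega>. layer A B (U \<omega>)) (\<lambda>\<omega>. layer d e (V \<omega>))"
    if [measurable]: "U \<in> borel_measurable M" "V \<in> borel_measurable M" and de: "d \<le> e"
    and pqd: "\<And>x y. prob {\<omega> \<in> space M. U \<omega> \<le> x} * prob {\<omega> \<in> space M. V \<omega> \<le> y}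
      \<le> prob {\<omega> \<in> space M. U \<omega> \<le> x \<and> V \<omega> \<le> y}" for U V :: "'a \<Rightarrow> real" and d e
  proof -
    have nn: "0 \<le> covariance M (\<lambda>\<omega>. layer s t (U \<omega>)) (\<lambda>\<omega>. layer d e (V \<omega>))" if "s \<le> t" for s t
      using that de pqd by (intro covariance_layer_nonneg) auto
    have "covariance M (\<lambda>\<omega>. layer A B (U \<omega>)) (\<lambda>\<omega>. layer d e (V \<omega>))
      = covariance M (\<lambda>\<omega>. layer A a (U \<omega>)) (\<lambda>\<omega>. layer d e (V \<omega>))
        + covariance M (\<lambda>\<omega>. layer a b (U \<omega>)) (\<lambda>\<omega>. layer d e (V \<omega>))
        + covariance M (\<lambda>\<omega>. layer b B (U \<omega>)) (\<lambda>\<omega>. layer d e (V \<omega>))"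
      using le de covariance_layer_split[of U V A a B d e] covariance_layer_split[of U V a b B d e] by simp
    then show ?thesis
      using nn[of A a] nn[of b B] le by simp
  qed
  have "covariance M (\<lambda>\<omega>. layer a b (X \<omega>)) (\<lambda>\<omega>. layer a b (Y \<omega>))
    \<le> covariance M (\<lambda>\<omega>. layer A B (X \<omega>)) (\<lambda>\<omega>. layer a b (Y \<omega>))"
    by (rule widen) (use le pqd in auto)
  also have "\<dots> = covariance M (\<lambda>\<omega>. layer a b (Y \<omega>)) (\<lambda>\<omega>. layer A B (X \<omega>))"
    by (rule covariance_commute)
  also have "\<dots> \<le> covariance M (\<lambda>\<omega>. layer A B (Y \<omega>)) (\<lambda>\<omega>. layer A B (X \<omega>))"
  proof (rule widen)
    fix x y show "prob {\<omega> \<in> space M. Y \<omega> \<le> x} * prob {\<omega> \<in> space M. X \<omega> \<le> y}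
      \<le> prob {\<omega> \<in> space M. Y \<omega> \<le> x \<and> X \<omega> \<le> y}"
      using pqd[of y x] by (simp add: mult.commute conj_commute)
  qed (use le in auto)
  finally show ?thesis by (simp add: covariance_commute)
qed

end

section \<open>Summability\<close>

text \<open>
  Summing over \<open>m\<close> first, each power \<open>x ^ j\<close> meets at most the whole sum of \<open>a\<close>.
\<close>

lemma suminf_shifted_convolution_summable:
  fixes a :: "nat \<Rightarrow> real" and x :: real
  assumes a: "summable a" "\<And>j. 0 \<le> a j" and x: "0 \<le> x" "x < 1"
  shows "summable (\<lambda>m. \<Sum>j. x ^ j * a (m + j))"
proof -
  have le: "a j \<le> suminf a" for j
    using a sum_le_suminf[of a "{j}"] by simp
  have sm: "summable (\<lambda>j. x ^ j * a (m + j))" for m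
  proof (rule summable_comparison_test'[where N = 0])
    show "summable (\<lambda>j. x ^ j * suminf a)"
      using x by (intro summable_mult2 summable_geometric) auto
    show "norm (x ^ j * a (m + j)) \<le> x ^ j * suminf a" for j
      using a x le by (auto simp: abs_mult intro!: mult_left_mono)
  qed
  show ?thesis
  proof (rule summableI_nonneg_bounded)
    show "0 \<le> (\<Sum>j. x ^ j * a (m + j))" for m
      using sm a x by (intro suminf_nonneg) auto
    fix N
    have "(\<Sum>m<N. \<Sum>j. x ^ j * a (m + j)) = (\<Sum>j. \<Sum>m<N. x ^ j * a (m + j))"
      using sm by (intro suminf_sum[symmetric]) auto
    also have "\<dots> \<le> (\<Sum>j. x ^ j * suminf a)"
    proof (rule suminf_le)
      fix j
      have "(\<Sum>m<N. a (m + j)) = sum a ((\<lambda>m. m + j) ` {..<N})"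
        by (simp add: sum.reindex)
      also have "\<dots> \<le> suminf a"
        using a by (intro sum_le_suminf) auto
      finally show "(\<Sum>m<N. x ^ j * a (m + j)) \<le> x ^ j * suminf a"
        using x by (auto simp: sum_distrib_left[symmetric] intro!: mult_left_mono)
    next
      show "summable (\<lambda>j. \<Sum>m<N. x ^ j * a (m + j))"
        using sm by (intro summable_sum) auto
      show "summable (\<lambda>j. x ^ j * suminf a)"
        using x by (intro summable_mult2 summable_geometric) auto
    qed
    finally show "(\<Sum>m<N. \<Sum>j. x ^ j * a (m + j)) \<le> (\<Sum>j. x ^ j * suminf a)" .
  qed
qed

lemma convolution_summable:
  fixes a b :: "nat \<Rightarrow> real"
  assumes "summable a" "\<And>i. 0 \<le> a i" "summable b" "\<And>i. 0 \<le> b i"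
  shows "summable (\<lambda>m. \<Sum>i\<le>m. a i * b (m - i))"
  using assms by (intro summable_Cauchy_product) auto

text \<open>
  The sum of the \<open>f m\<close> has finite integral, hence is finite almost everywhere, and the terms of a
  convergent series vanish in the limit. This replaces Chebyshev's inequality followed by the
  Borel-Cantelli lemma.
\<close>

lemma (in finite_measure) AE_tendsto_zero_of_summable_integral:
  fixes f :: "nat \<Rightarrow> 'a \<Rightarrow> real"
  assumes int: "\<And>m. integrable M (f m)" and nn: "\<And>m \<omega>. 0 \<le> f m \<omega>"
    and sm: "summable (\<lambda>m. integral\<^sup>L M (f m))"
  shows "AE \<omega> in M. (\<lambda>m. f m \<omega>) \<longlonglongrightarrow> 0"
proof -
  have [measurable]: "f m \<in> borel_measurable M" for m
    using int by auto
  have "(\<integral>\<^sup>+\<omega>. (\<Sum>m. ennreal (f m \<omega>)) \<partial>M) = (\<Sum>m. \<integral>\<^sup>+\<omega>. ennreal (f m \<omega>) \<partial>M)"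
    by (rule nn_integral_suminf) auto
  also have "\<dots> = (\<Sum>m. ennreal (integral\<^sup>L M (f m)))"
    using int nn by (simp add: nn_integral_eq_integral)
  also have "\<dots> < \<infinity>"
    using sm nn by (simp add: suminf_ennreal2)
  finally have "AE \<omega> in M. (\<Sum>m. ennreal (f m \<omega>)) \<noteq> \<infinity>"
    by (intro nn_integral_PInf_AE) auto
  then show ?thesis
  proof eventually_elim
    case (elim \<omega>)
    then have "summable (\<lambda>m. f m \<omega>)"
      using nn by (intro summable_suminf_not_top) auto
    then show ?case by (rule summable_LIMSEQ_zero)
  qed
qed

section \<open>Chaining over dyadic blocks\<close>

definition block :: "nat \<Rightarrow> nat \<Rightarrow> nat set" where
  "block i l = {l * 2 ^ i ..< Suc l * 2 ^ i}"

lemma finite_block [simp, intro]: "finite (block i l)"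
  by (simp add: block_def)

lemma card_block: "card (block i l) = 2 ^ i"
  by (simp add: block_def)

lemma in_block_iff: "k \<in> block i l \<longleftrightarrow> k div 2 ^ i = l"
proof -
  have "k div 2 ^ i = l \<longleftrightarrow> l * 2 ^ i \<le> k \<and> k < Suc l * 2 ^ i"
    by (metis div_nat_eqI dividend_less_div_times le_refl mult.commute mult_Suc pos2 zero_less_power
        div_times_less_eq_dividend add.commute)
  then show ?thesis by (simp add: block_def)
qed

lemma block_subset:
  assumes "i \<le> m" "l < 2 ^ (m - i)"
  shows "block i l \<subseteq> {..<2 ^ m}"
proof
  fix k assume "k \<in> block i l"
  then have "k < Suc l * 2 ^ i" by (simp add: block_def)
  also have "\<dots> \<le> 2 ^ (m - i) * 2 ^ i" using assms by (intro mult_right_mono) auto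
  also have "\<dots> = 2 ^ m" using assms by (simp add: power_add[symmetric])
  finally show "k \<in> {..<2 ^ m}" by simp
qed

text \<open>
  What chaining needs of a sequence: nonnegative terms, uniform tail bounds at the levels \<open>r ^ j\<close>
  that are summable against \<open>2 ^ j\<close>, and nonnegative covariances of layers whose sum over the
  pairs below \<open>2 ^ m\<close> grows strictly slower than \<open>r ^ (2 * m)\<close>. In the application
  \<open>r = 2 powr (1 / p)\<close> and \<open>\<beta> = 2 powr (2 / \<alpha>)\<close>. The index starts at \<open>0\<close>, so that
  dyadic blocks are the fibres of integer division by a power of two.
\<close>

locale layered_sequence = prob_space M for M :: "'a measure" +
  fixes Z :: "nat \<Rightarrow> 'a \<Rightarrow> real" and q :: "nat \<Rightarrow> real" and r \<beta> K :: real
  assumes Z_measurable [measurable]: "\<And>k. Z k \<in> borel_measurable M"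
    and Z_nonneg: "\<And>k \<omega>. 0 \<le> Z k \<omega>"
    and r_gt_1: "1 < r" and r_less_2: "r < 2"
    and beta_ge_2: "2 \<le> \<beta>" and beta_less: "\<beta> < r\<^sup>2"
    and tail_le: "\<And>k j. prob {\<omega> \<in> space M. r ^ j < Z k \<omega>} \<le> q j"
    and tail_summable: "summable (\<lambda>j. 2 ^ j * q j)"
    and cov_nonneg: "\<And>k l a b. k \<noteq> l \<Longrightarrow> 0 \<le> a \<Longrightarrow> a \<le> b \<Longrightarrow>
      0 \<le> covariance M (\<lambda>\<omega>. layer a b (Z k \<omega>)) (\<lambda>\<omega>. layer a b (Z l \<omega>))"
    and cov_sum_le: "\<And>m a b. 0 \<le> a \<Longrightarrow> a \<le> b \<Longrightarrow> b \<le> r ^ m \<Longrightarrow>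
      (\<Sum>(k, l)\<in>{(k, l). k < 2 ^ m \<and> l < 2 ^ m \<and> k \<noteq> l}.
        covariance M (\<lambda>\<omega>. layer a b (Z k \<omega>)) (\<lambda>\<omega>. layer a b (Z l \<omega>))) \<le> K * \<beta> ^ m"
begin

lemma q_nonneg: "0 \<le> q j"
  using tail_le[of j 0] measure_nonneg[of M] by (meson order_trans)

lemma r_pos [simp]: "0 < r" and r_pow_pos [simp]: "0 < r ^ j"
  and r_nonneg [simp]: "0 \<le> r" and r_pow_nonneg [simp]: "0 \<le> r ^ j"
  using r_gt_1 by auto

lemma tail_indicator_integrable [simp]:
  "integrable M (indicator {\<omega> \<in> space M. t < Z k \<omega>} :: 'a \<Rightarrow> real)"
  by (rule integrable_real_indicator) (auto simp: emeasure_eq_measure)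

lemma r_pow_le_Suc: "r ^ j \<le> r ^ Suc j"
  using r_gt_1 by simp

definition mean :: "real \<Rightarrow> real \<Rightarrow> nat \<Rightarrow> real" where
  "mean a b k = expectation (\<lambda>\<omega>. layer a b (Z k \<omega>))"

definition csum :: "real \<Rightarrow> real \<Rightarrow> nat set \<Rightarrow> 'a \<Rightarrow> real" where
  "csum a b I \<omega> = (\<Sum>k\<in>I. layer a b (Z k \<omega>) - mean a b k)"

lemma mean_nonneg: "0 \<le> mean a b k"
  unfolding mean_def by (intro Bochner_Integration.integral_nonneg) (simp add: layer_nonneg)

lemma csum_ivl:
  fixes x y z :: nat
  shows "x \<le> y \<Longrightarrow> y \<le> z \<Longrightarrow> csum a b {x..<z} \<omega> = csum a b {x..<y} \<omega> + csum a b {y..<z} \<omega>"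
  by (simp add: csum_def sum.atLeastLessThan_concat)

lemma csum_layer_add:
  assumes "a \<le> b" "b \<le> c"
  shows "csum a c I \<omega> = csum a b I \<omega> + csum b c I \<omega>"
proof -
  have "mean a c k = mean a b k + mean b c k" for k
    using assms unfolding mean_def by (simp add: layer_add[OF assms])
  then show ?thesis
    by (simp add: csum_def layer_add[OF assms] sum.distrib[symmetric] algebra_simps)
qed

text \<open>
  Since layers are nonnegative, the uncentred sum over a part lies between \<open>0\<close> and the sum over the
  whole; passing to centred sums costs at most the means.
\<close>

lemma csum_subset_le:
  fixes c :: real
  assumes "finite B" "J \<subseteq> B" and mean: "\<And>k. k \<in> B \<Longrightarrow> mean a b k \<le> c"
  shows "\<bar>csum a b J \<omega>\<bar> \<le> \<bar>csum a b B \<omega>\<bar> + card B * c"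
proof -
  have "(\<Sum>k\<in>J. layer a b (Z k \<omega>)) \<le> (\<Sum>k\<in>B. layer a b (Z k \<omega>))"
    using assms by (intro sum_mono2) (auto simp: layer_nonneg)
  moreover have "0 \<le> (\<Sum>k\<in>J. layer a b (Z k \<omega>))" by (intro sum_nonneg) (auto simp: layer_nonneg)
  moreover have "(\<Sum>k\<in>J. mean a b k) \<le> (\<Sum>k\<in>B. mean a b k)"
    using assms by (intro sum_mono2) (auto simp: mean_nonneg)
  moreover have "0 \<le> (\<Sum>k\<in>J. mean a b k)" by (intro sum_nonneg) (auto simp: mean_nonneg)
  moreover have "(\<Sum>k\<in>B. mean a b k) \<le> card B * c"
    using mean by (rule sum_bounded_above)
  ultimately show ?thesis
    unfolding csum_def sum_subtractf by linarith
qed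

lemma mean_layer_le: "mean (r ^ s) (r ^ Suc s) k \<le> r ^ Suc s * q s"
proof -
  have [measurable]: "{\<omega> \<in> space M. r ^ s < Z k \<omega>} \<in> events" by measurable
  have "mean (r ^ s) (r ^ Suc s) k
      \<le> expectation (\<lambda>\<omega>. r ^ Suc s * indicator {\<omega> \<in> space M. r ^ s < Z k \<omega>} \<omega>)"
    unfolding mean_def
  proof (rule integral_mono)
    fix \<omega> assume "\<omega> \<in> space M"
    moreover have "layer (r ^ s) (r ^ Suc s) (Z k \<omega>) \<le> r ^ Suc s"
      using layer_le[OF r_pow_le_Suc, of s "Z k \<omega>"] r_pow_pos[of s] by linarith
    moreover have "layer (r ^ s) (r ^ Suc s) (Z k \<omega>) = 0" if "\<not> r ^ s < Z k \<omega>"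
      using that by (simp add: layer_def)
    ultimately show "layer (r ^ s) (r ^ Suc s) (Z k \<omega>) \<le> r ^ Suc s * indicator {\<omega> \<in> space M. r ^ s < Z k \<omega>} \<omega>"
      by (cases "r ^ s < Z k \<omega>") (simp_all del: power_Suc)
  qed (use r_pow_le_Suc in \<open>auto simp del: power_Suc\<close>)
  also have "\<dots> = r ^ Suc s * prob {\<omega> \<in> space M. r ^ s < Z k \<omega>}" by simp
  also have "\<dots> \<le> r ^ Suc s * q s"
    using tail_le by (intro mult_left_mono) auto
  finally show ?thesis .
qed

text \<open>
  The chaining step. With \<open>x = n\<^bsub>i+1\<^esub> \<le> y = n\<^sub>i \<le> n\<close>, where \<open>n\<^sub>i = n div 2 ^ i * 2 ^ i\<close>, the sum over
  \<open>{x..<n}\<close> truncated at \<open>r ^ Suc i\<close> is the sum of three terms: the layer above \<open>r ^ i\<close> over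
  \<open>{x..<n}\<close>, which is part of one block at level \<open>i + 1\<close>; the truncation at \<open>r ^ i\<close> over \<open>{x..<y}\<close>,
  which is empty or one block at level \<open>i\<close>; and the truncation at \<open>r ^ i\<close> over \<open>{y..<n}\<close>, to which
  the induction hypothesis applies.
\<close>

lemma chaining:
  assumes n: "n < 2 ^ m" and "i \<le> m"
    and U: "\<And>s l. s < i \<Longrightarrow> l < 2 ^ (m - s) \<Longrightarrow> \<bar>csum 0 (r ^ s) (block s l) \<omega>\<bar> \<le> U s"
    and W: "\<And>s l. s < i \<Longrightarrow> l < 2 ^ (m - Suc s) \<Longrightarrow>
      \<bar>csum (r ^ s) (r ^ Suc s) (block (Suc s) l) \<omega>\<bar> \<le> W s"
  shows "\<bar>csum 0 (r ^ i) {n div 2 ^ i * 2 ^ i ..< n} \<omega>\<bar>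
    \<le> (\<Sum>s<i. U s + W s + 2 ^ Suc s * (r ^ Suc s * q s))"
  using assms(2-)
proof (induction i)
  case 0
  then show ?case by (simp add: csum_def)
next
  case (Suc i)
  let ?x = "n div 2 ^ Suc i * 2 ^ Suc i" and ?y = "n div 2 ^ i * 2 ^ i"
  let ?l = "n div 2 ^ Suc i"
  have dd: "?l = n div 2 ^ i div 2" by (metis div_mult2_eq mult.commute power_Suc)
  have xy: "?x \<le> ?y" and yn: "?y \<le> n"
    unfolding dd by simp_all
  have ln: "?l < 2 ^ (m - Suc i)"
    using n Suc.prems(1) by (intro less_mult_imp_div_less) (simp add: power_add[symmetric] del: power_Suc)
  have kn: "n div 2 ^ i < 2 ^ (m - i)"
    using n Suc.prems(1) by (intro less_mult_imp_div_less) (simp add: power_add[symmetric] del: power_Suc)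
  have sub: "{?x..<n} \<subseteq> block (Suc i) ?l"
    unfolding block_def using dividend_less_div_times[of "2 ^ Suc i" n] by (auto simp del: power_Suc simp: add.commute)
  have "\<bar>csum (r ^ i) (r ^ Suc i) {?x..<n} \<omega>\<bar>
      \<le> \<bar>csum (r ^ i) (r ^ Suc i) (block (Suc i) ?l) \<omega>\<bar> + card (block (Suc i) ?l) * (r ^ Suc i * q i)"
    by (rule csum_subset_le) (use sub mean_layer_le in auto)
  also have "\<dots> \<le> W i + 2 ^ Suc i * (r ^ Suc i * q i)"
    using Suc.prems(3)[OF _ ln] by (simp add: card_block del: power_Suc)
  finally have top: "\<bar>csum (r ^ i) (r ^ Suc i) {?x..<n} \<omega>\<bar> \<le> W i + 2 ^ Suc i * (r ^ Suc i * q i)" .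
  \<comment> \<open>the binary digit of \<open>n\<close> at position \<open>i\<close> decides whether there is a block between \<open>x\<close> and \<open>y\<close>\<close>
  have mid: "\<bar>csum 0 (r ^ i) {?x..<?y} \<omega>\<bar> \<le> U i"
  proof (cases "even (n div 2 ^ i)")
    case True
    then have "?x = ?y" unfolding dd by auto
    moreover have "0 \<le> U i" using Suc.prems(2)[of i 0] by auto
    ultimately show ?thesis by (simp add: csum_def)
  next
    case False
    then have *: "n div 2 ^ i = Suc (2 * ?l)" unfolding dd by (auto elim!: oddE)
    have "{?x..<?y} = block i (2 * ?l)"
      unfolding block_def * by (simp add: mult_ac)
    then show ?thesis
      using Suc.prems(2)[of i "2 * ?l"] kn * by auto
  qed
  have rest: "\<bar>csum 0 (r ^ i) {?y..<n} \<omega>\<bar> \<le> (\<Sum>s<i. U s + W s + 2 ^ Suc s * (r ^ Suc s * q s))"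
    using Suc.prems by (intro Suc.IH) auto
  have "csum 0 (r ^ Suc i) {?x..<n} \<omega> = csum (r ^ i) (r ^ Suc i) {?x..<n} \<omega>
      + (csum 0 (r ^ i) {?x..<?y} \<omega> + csum 0 (r ^ i) {?y..<n} \<omega>)"
    using csum_layer_add[of 0 "r ^ i" "r ^ Suc i"] csum_ivl[OF xy yn] r_pow_le_Suc
    by (simp add: less_imp_le del: power_Suc)
  then show ?case
    using top mid rest by (simp del: power_Suc)
qed

text \<open>
  A dyadic form of \<open>E (min Z b)\<^sup>2 = \<integral> 2 t P (Z > t) dt\<close> (integrated over \<open>0 < t < b\<close>): each time
  \<open>z\<close> passes a level \<open>r ^ j\<close> the bound grows by the square of the next level.
\<close>

lemma layer_sq_le:
  assumes "0 \<le> a" "a \<le> b" "b \<le> r ^ i" "0 \<le> z"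
  shows "(layer a b z)\<^sup>2 \<le> 1 + (\<Sum>j<i. r ^ (2 * Suc j) * indicator {z. r ^ j < z} z)"
proof -
  have "(min (r ^ i) z)\<^sup>2 \<le> 1 + (\<Sum>j<i. r ^ (2 * Suc j) * indicator {z. r ^ j < z} z)"
  proof (induction i)
    case 0
    then show ?case using assms(4) by (simp add: power_le_one)
  next
    case (Suc i)
    show ?case
    proof (cases "r ^ i < z")
      case True
      have "(min (r ^ Suc i) z)\<^sup>2 \<le> (r ^ Suc i)\<^sup>2"
        using assms(4) by (intro power_mono) auto
      also have "\<dots> = r ^ (2 * Suc i)" by (simp add: power_mult[symmetric] mult.commute del: power_Suc)
      also have "\<dots> \<le> 1 + (\<Sum>j<Suc i. r ^ (2 * Suc j) * indicator {z. r ^ j < z} z)"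
        using True by (auto simp: sum_nonneg)
      finally show ?thesis .
    next
      case False
      then have "min (r ^ Suc i) z = min (r ^ i) z"
        using r_pow_le_Suc[of i] by (simp add: min_def del: power_Suc)
      then show ?thesis using Suc False by simp
    qed
  qed
  moreover have "(layer a b z)\<^sup>2 \<le> (min (r ^ i) z)\<^sup>2"
    using assms by (intro power_mono layer_nonneg) (auto simp: layer_def)
  ultimately show ?thesis by simp
qed

definition sq_bound :: "nat \<Rightarrow> real" where
  "sq_bound i = 1 + (\<Sum>j<i. r ^ (2 * Suc j) * q j)"

lemma layer_second_moment_le:
  assumes "0 \<le> a" "a \<le> b" "b \<le> r ^ i"
  shows "expectation (\<lambda>\<omega>. (layer a b (Z k \<omega>))\<^sup>2) \<le> sq_bound i"
proof -
  have [measurable]: "{\<omega> \<in> space M. r ^ j < Z k \<omega>} \<in> events" for j by measurable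
  have "expectation (\<lambda>\<omega>. (layer a b (Z k \<omega>))\<^sup>2)
      \<le> expectation (\<lambda>\<omega>. 1 + (\<Sum>j<i. r ^ (2 * Suc j) * indicator {\<omega> \<in> space M. r ^ j < Z k \<omega>} \<omega>))"
  proof (rule integral_mono)
    show "integrable M (\<lambda>\<omega>. (layer a b (Z k \<omega>))\<^sup>2)"
      using assms by (simp add: power2_eq_square)
    show "integrable M (\<lambda>\<omega>. 1 + (\<Sum>j<i. r ^ (2 * Suc j) * indicator {\<omega> \<in> space M. r ^ j < Z k \<omega>} \<omega>))"
      by (intro Bochner_Integration.integrable_add Bochner_Integration.integrable_sum
          integrable_mult_right integrable_real_indicator) (auto simp: emeasure_eq_measure)
    fix \<omega> assume "\<omega> \<in> space M"
    then show "(layer a b (Z k \<omega>))\<^sup>2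
        \<le> 1 + (\<Sum>j<i. r ^ (2 * Suc j) * indicator {\<omega> \<in> space M. r ^ j < Z k \<omega>} \<omega>)"
      using layer_sq_le[OF assms Z_nonneg[of k \<omega>]] by (simp add: indicator_def)
  qed
  also have "\<dots> = 1 + (\<Sum>j<i. r ^ (2 * Suc j) * prob {\<omega> \<in> space M. r ^ j < Z k \<omega>})"
  proof -
    have int: "integrable M (\<lambda>\<omega>. r ^ (2 * Suc j) * indicator {\<omega> \<in> space M. r ^ j < Z k \<omega>} \<omega>)" for j
      by (intro integrable_mult_right integrable_real_indicator) (auto simp: emeasure_eq_measure)
    show ?thesis
      by (subst Bochner_Integration.integral_add, simp, intro Bochner_Integration.integrable_sum int,
          subst Bochner_Integration.integral_sum, rule int,
          subst integral_mult_right_zero, subst Bochner_Integration.integral_indicator)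
         (simp_all add: prob_space Int_absorb2 subset_eq)
  qed
  also have "\<dots> \<le> sq_bound i"
    unfolding sq_bound_def using tail_le by (intro add_left_mono sum_mono mult_left_mono) auto
  finally show ?thesis .
qed

lemma covariance_layer_self_le:
  assumes "0 \<le> a" "a \<le> b" "b \<le> r ^ i"
  shows "covariance M (\<lambda>\<omega>. layer a b (Z k \<omega>)) (\<lambda>\<omega>. layer a b (Z k \<omega>)) \<le> sq_bound i"
proof -
  have "covariance M (\<lambda>\<omega>. layer a b (Z k \<omega>)) (\<lambda>\<omega>. layer a b (Z k \<omega>))
      \<le> expectation (\<lambda>\<omega>. (layer a b (Z k \<omega>))\<^sup>2)"
    using assms by (subst covariance_eq) (auto simp: power2_eq_square)
  then show ?thesis using layer_second_moment_le[OF assms, of k] by linarith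
qed

lemma sq_bound_nonneg: "0 \<le> sq_bound i"
  unfolding sq_bound_def by (intro add_nonneg_nonneg sum_nonneg mult_nonneg_nonneg q_nonneg) auto

lemma
  assumes "a \<le> b" "finite I"
  shows csum_sq_integrable: "integrable M (\<lambda>\<omega>. (csum a b I \<omega>)\<^sup>2)"
    and expectation_csum_sq: "expectation (\<lambda>\<omega>. (csum a b I \<omega>)\<^sup>2)
      = (\<Sum>(k, l)\<in>I \<times> I. covariance M (\<lambda>\<omega>. layer a b (Z k \<omega>)) (\<lambda>\<omega>. layer a b (Z l \<omega>)))"
proof -
  have *: "(csum a b I \<omega>)\<^sup>2 = (\<Sum>(k, l)\<in>I \<times> I.
      (layer a b (Z k \<omega>) - mean a b k) * (layer a b (Z l \<omega>) - mean a b l))" for \<omega>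
    by (simp add: csum_def power2_eq_square sum_product sum.cartesian_product)
  have int: "integrable M (\<lambda>\<omega>. (layer a b (Z k \<omega>) - mean a b k) * (layer a b (Z l \<omega>) - mean a b l))" for k l
    using assms by (auto simp: algebra_simps)
  show "integrable M (\<lambda>\<omega>. (csum a b I \<omega>)\<^sup>2)"
    unfolding * by (intro Bochner_Integration.integrable_sum) (auto simp: split_beta intro: int)
  show "expectation (\<lambda>\<omega>. (csum a b I \<omega>)\<^sup>2)
      = (\<Sum>(k, l)\<in>I \<times> I. covariance M (\<lambda>\<omega>. layer a b (Z k \<omega>)) (\<lambda>\<omega>. layer a b (Z l \<omega>)))"
    unfolding * by (subst Bochner_Integration.integral_sum)
      (auto simp: split_beta covariance_def mean_def[symmetric] intro: int)
qed

text \<open>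
  The squares \<open>B \<times> B\<close> of the blocks at level \<open>i\<close> are disjoint. On the diagonal there are \<open>2 ^ m\<close>
  variances; off the diagonal the covariances are nonnegative, so their sum is at most the sum
  over all pairs.
\<close>

lemma block_second_moments_le:
  assumes i: "i \<le> m" and ab: "0 \<le> a" "a \<le> b" "b \<le> r ^ i"
  shows "(\<Sum>l<2 ^ (m - i). expectation (\<lambda>\<omega>. (csum a b (block i l) \<omega>)\<^sup>2)) \<le> 2 ^ m * sq_bound i + K * \<beta> ^ m"
proof -
  let ?c = "\<lambda>(k, l). covariance M (\<lambda>\<omega>. layer a b (Z k \<omega>)) (\<lambda>\<omega>. layer a b (Z l \<omega>))"
  let ?L = "{..<2 ^ (m - i)} :: nat set"
  let ?D = "(\<lambda>k. (k, k)) ` {..<2 ^ m} :: (nat \<times> nat) set"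
  let ?O = "{(k, l). k < 2 ^ m \<and> l < 2 ^ m \<and> k \<noteq> l} :: (nat \<times> nat) set"
  let ?B = "\<Union>l\<in>?L. block i l \<times> block i l"
  have fO: "finite ?O"
    by (rule finite_subset[of _ "{..<2 ^ m} \<times> {..<2 ^ m}"]) auto
  have "b \<le> r ^ m"
    using ab i r_gt_1 by (meson order_trans power_increasing less_imp_le)
  have "(\<Sum>l\<in>?L. expectation (\<lambda>\<omega>. (csum a b (block i l) \<omega>)\<^sup>2)) = (\<Sum>l\<in>?L. \<Sum>x\<in>block i l \<times> block i l. ?c x)"
    using ab by (simp add: expectation_csum_sq)
  also have "\<dots> = (\<Sum>x\<in>?B. ?c x)"
    by (rule sum.UNION_disjoint[symmetric]) (auto simp: in_block_iff)
  also have "\<dots> \<le> (\<Sum>x\<in>?B \<inter> ?D. ?c x) + (\<Sum>x\<in>?B - ?D. ?c x)"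
    by (subst sum.Int_Diff[where B = ?D]) auto
  also have "(\<Sum>x\<in>?B \<inter> ?D. ?c x) \<le> (\<Sum>x\<in>?B \<inter> ?D. sq_bound i)"
    using covariance_layer_self_le[OF ab] by (intro sum_mono) auto
  also have "\<dots> \<le> (\<Sum>x\<in>?D. sq_bound i)"
    by (intro sum_mono2) (auto simp: sq_bound_nonneg)
  also have "\<dots> = 2 ^ m * sq_bound i"
    by (subst sum.reindex) (auto simp: inj_on_def)
  also have "(\<Sum>x\<in>?B - ?D. ?c x) \<le> (\<Sum>x\<in>?O. ?c x)"
  proof (rule sum_mono2[OF fO])
    show "?B - ?D \<subseteq> ?O"
      using block_subset[OF i] by (fastforce simp: image_iff)
  qed (use cov_nonneg ab in auto)
  also have "\<dots> \<le> K * \<beta> ^ m"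
    using cov_sum_le[OF ab(1,2) \<open>b \<le> r ^ m\<close>] by (simp add: split_beta)
  finally show ?thesis by simp
qed

section \<open>The strong law for nonnegative sequences\<close>

text \<open>
  Any ratio with \<open>1 < rho\<^sup>2 < r\<^sup>2 / \<beta>\<close> would serve; here \<open>rho\<^sup>2\<close> is the midpoint. The lower bound makes
  the bounds for single blocks summable over the scales, the upper bound keeps the weighted
  covariances geometrically small.
\<close>

definition rho :: real where
  "rho = sqrt ((1 + r\<^sup>2 / \<beta>) / 2)"

lemma beta_pos: "0 < \<beta>"
  using beta_ge_2 by simp

lemma two_less_r_sq: "2 < r\<^sup>2"
  using beta_ge_2 beta_less by simp

lemma rho_sq: "rho\<^sup>2 = (1 + r\<^sup>2 / \<beta>) / 2"
  using beta_pos by (simp add: rho_def)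

lemma rho_gt_1: "1 < rho"
proof -
  have "1 < r\<^sup>2 / \<beta>" using beta_less beta_pos by simp
  then show ?thesis by (simp add: rho_def)
qed

lemma rho_sq_beta_less: "rho\<^sup>2 * \<beta> < r\<^sup>2"
  unfolding rho_sq using beta_less beta_pos by (simp add: field_simps)

lemma rho_sq_2_less: "rho\<^sup>2 * 2 < r\<^sup>2"
  using mult_left_mono[OF beta_ge_2, of "rho\<^sup>2"] rho_sq_beta_less by simp

text \<open>
  For \<open>i = 0\<close> the exponent \<open>i - 1\<close> is \<open>0\<close>, and the second square belongs to the empty layer from \<open>1\<close>
  to \<open>1\<close>.
\<close>

definition energy :: "nat \<Rightarrow> 'a \<Rightarrow> real" where
  "energy m \<omega> = (\<Sum>i\<le>m. rho ^ (2 * (m - i)) / r ^ (2 * m) *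
    (\<Sum>l<2 ^ (m - i). (csum 0 (r ^ i) (block i l) \<omega>)\<^sup>2
                       + (csum (r ^ (i - 1)) (r ^ i) (block i l) \<omega>)\<^sup>2))"

lemma r_neq_0 [simp]: "r \<noteq> 0"
  using r_pos by linarith

lemma r_pow_pred_le: "r ^ (i - Suc 0) \<le> r ^ i"
  using r_gt_1 by (intro power_increasing) auto

lemma energy_integrable: "integrable M (energy m)"
  unfolding energy_def
  by (intro Bochner_Integration.integrable_sum integrable_mult_right Bochner_Integration.integrable_add
      csum_sq_integrable) (auto simp: r_pow_pred_le)

lemma energy_nonneg: "0 \<le> energy m \<omega>"
  unfolding energy_def using rho_gt_1 by (intro sum_nonneg mult_nonneg_nonneg) auto

text \<open>
  Here \<open>r\<^sup>2 > 2\<close>, that is \<open>p < 2\<close>, is used: exchanging the order of summation turns the sum over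
  \<open>i > j\<close> into a geometric series, leaving a multiple of \<open>2 ^ j * q j\<close>.
\<close>

lemma sq_bound_summable: "summable (\<lambda>i. (2 / r\<^sup>2) ^ i * sq_bound i)"
proof -
  define x where "x = 2 / r\<^sup>2"
  have x: "0 \<le> x" "x < 1" using two_less_r_sq by (auto simp: x_def divide_less_eq)
  have geo: "summable (\<lambda>i. x ^ i)" using x by (intro summable_geometric) auto
  have "summable (\<lambda>i. x ^ i + (\<Sum>j\<le>i. (r\<^sup>2 * (2 ^ j * q j)) * x ^ (i - j)))"
    using geo tail_summable q_nonneg x
    by (intro summable_add convolution_summable summable_mult) auto
  then have "summable (\<lambda>i. x ^ i * sq_bound i)"
  proof (rule summable_comparison_test'[where N = 0])
    fix i
    have *: "x ^ i * (r ^ (2 * Suc j) * q j) = r\<^sup>2 * (2 ^ j * q j) * x ^ (i - j)" if "j < i" for j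
    proof -
      obtain d where i: "i = j + d" using \<open>j < i\<close> less_imp_add_positive by blast
      have "x ^ j * r ^ (2 * Suc j) = r\<^sup>2 * 2 ^ j"
        by (simp add: x_def power_divide power_mult power2_eq_square)
      then show ?thesis by (simp add: i power_add algebra_simps del: power_Suc)
    qed
    have "x ^ i * sq_bound i = x ^ i + (\<Sum>j<i. r\<^sup>2 * (2 ^ j * q j) * x ^ (i - j))"
      unfolding sq_bound_def distrib_left sum_distrib_left by (intro arg_cong2[where f = "(+)"] sum.cong) (auto simp only: * lessThan_iff mult_1_right)
    also have "\<dots> \<le> x ^ i + (\<Sum>j\<le>i. r\<^sup>2 * (2 ^ j * q j) * x ^ (i - j))"
      using x q_nonneg by (intro add_left_mono sum_mono2) auto
    finally show "norm (x ^ i * sq_bound i) \<le> x ^ i + (\<Sum>j\<le>i. r\<^sup>2 * (2 ^ j * q j) * x ^ (i - j))"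
      using x sq_bound_nonneg by simp
  qed
  then show ?thesis by (simp add: x_def)
qed

text \<open>
  Both sums are convolutions of a summable sequence with a geometric one, which is the form that
  makes them summable in \<open>m\<close>.
\<close>

lemma expectation_energy_le:
  "expectation (energy m) \<le> 2 * (\<Sum>i\<le>m. ((2 / r\<^sup>2) ^ i * sq_bound i) * (2 * rho\<^sup>2 / r\<^sup>2) ^ (m - i))
     + 2 * K * (\<Sum>i\<le>m. (\<beta> / r\<^sup>2) ^ i * (rho\<^sup>2 * \<beta> / r\<^sup>2) ^ (m - i))"
proof -
  let ?U = "\<lambda>i l. expectation (\<lambda>\<omega>. (csum 0 (r ^ i) (block i l) \<omega>)\<^sup>2)"
  let ?W = "\<lambda>i l. expectation (\<lambda>\<omega>. (csum (r ^ (i - 1)) (r ^ i) (block i l) \<omega>)\<^sup>2)"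
  have intU: "integrable M (\<lambda>\<omega>. (csum 0 (r ^ i) (block i l) \<omega>)\<^sup>2)"
    and intW: "integrable M (\<lambda>\<omega>. (csum (r ^ (i - 1)) (r ^ i) (block i l) \<omega>)\<^sup>2)" for i l
    by (auto intro!: csum_sq_integrable simp: r_pow_pred_le)
  have "expectation (energy m) = (\<Sum>i\<le>m. rho ^ (2 * (m - i)) / r ^ (2 * m) *
      ((\<Sum>l<2 ^ (m - i). ?U i l) + (\<Sum>l<2 ^ (m - i). ?W i l)))"
    unfolding energy_def
    by (subst Bochner_Integration.integral_sum)
      (auto simp: sum.distrib intU intW[unfolded One_nat_def])
  also have "\<dots> \<le> (\<Sum>i\<le>m. rho ^ (2 * (m - i)) / r ^ (2 * m) *
      ((2 ^ m * sq_bound i + K * \<beta> ^ m) + (2 ^ m * sq_bound i + K * \<beta> ^ m)))"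
    using rho_gt_1 by (intro sum_mono mult_left_mono add_mono block_second_moments_le)
      (auto simp: r_pow_pred_le)
  also have "\<dots> = (\<Sum>i\<le>m. 2 * (((2 / r\<^sup>2) ^ i * sq_bound i) * (2 * rho\<^sup>2 / r\<^sup>2) ^ (m - i))
      + 2 * K * ((\<beta> / r\<^sup>2) ^ i * (rho\<^sup>2 * \<beta> / r\<^sup>2) ^ (m - i)))"
  proof (rule sum.cong[OF refl])
    fix i assume "i \<in> {..m}"
    then obtain d where m: "m = i + d" using le_iff_add by auto
    show "rho ^ (2 * (m - i)) / r ^ (2 * m) * ((2 ^ m * sq_bound i + K * \<beta> ^ m) + (2 ^ m * sq_bound i + K * \<beta> ^ m))
      = 2 * (((2 / r\<^sup>2) ^ i * sq_bound i) * (2 * rho\<^sup>2 / r\<^sup>2) ^ (m - i))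
      + 2 * K * ((\<beta> / r\<^sup>2) ^ i * (rho\<^sup>2 * \<beta> / r\<^sup>2) ^ (m - i))"
    proof -
      have "x ^ d / y ^ (i + d) * ((2 ^ (i + d) * sq_bound i + K * \<beta> ^ (i + d)) + (2 ^ (i + d) * sq_bound i + K * \<beta> ^ (i + d)))
        = 2 * (((2 / y) ^ i * sq_bound i) * (2 * x / y) ^ d) + 2 * K * ((\<beta> / y) ^ i * (x * \<beta> / y) ^ d)"
        if "y \<noteq> 0" for x y :: real
        using that by (simp add: power_add power_mult_distrib power_divide field_simps)
      from this[of "r\<^sup>2" "rho\<^sup>2"] show ?thesis
        by (simp add: m power_mult del: distrib_left_numeral)
    qed
  qed
  also have "\<dots> = 2 * (\<Sum>i\<le>m. ((2 / r\<^sup>2) ^ i * sq_bound i) * (2 * rho\<^sup>2 / r\<^sup>2) ^ (m - i))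
     + 2 * K * (\<Sum>i\<le>m. (\<beta> / r\<^sup>2) ^ i * (rho\<^sup>2 * \<beta> / r\<^sup>2) ^ (m - i))"
    by (simp add: sum.distrib sum_distrib_left)
  finally show ?thesis .
qed

lemma expectation_energy_summable: "summable (\<lambda>m. expectation (energy m))"
proof (rule summable_comparison_test'[where N = 0])
  show "summable (\<lambda>m. 2 * (\<Sum>i\<le>m. ((2 / r\<^sup>2) ^ i * sq_bound i) * (2 * rho\<^sup>2 / r\<^sup>2) ^ (m - i))
     + 2 * K * (\<Sum>i\<le>m. (\<beta> / r\<^sup>2) ^ i * (rho\<^sup>2 * \<beta> / r\<^sup>2) ^ (m - i)))"
  proof (intro summable_add summable_mult convolution_summable)
    show "summable (\<lambda>i. (2 * rho\<^sup>2 / r\<^sup>2) ^ i)"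
      using rho_sq_2_less by (intro summable_geometric) (auto simp: mult.commute divide_less_eq)
    show "summable (\<lambda>i. (rho\<^sup>2 * \<beta> / r\<^sup>2) ^ i)"
      using rho_sq_beta_less beta_pos by (intro summable_geometric) auto
    show "summable (\<lambda>i. (\<beta> / r\<^sup>2) ^ i)"
      using beta_less beta_pos by (intro summable_geometric) auto
  qed (use sq_bound_summable sq_bound_nonneg beta_pos in auto)
  show "norm (expectation (energy m)) \<le> 2 * (\<Sum>i\<le>m. ((2 / r\<^sup>2) ^ i * sq_bound i) * (2 * rho\<^sup>2 / r\<^sup>2) ^ (m - i))
     + 2 * K * (\<Sum>i\<le>m. (\<beta> / r\<^sup>2) ^ i * (rho\<^sup>2 * \<beta> / r\<^sup>2) ^ (m - i))" for m
    using expectation_energy_le[of m] energy_nonneg by (simp add: Bochner_Integration.integral_nonneg)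
qed

text \<open>
  The square of a single block sum, with its weight, is at most \<open>energy m\<close>, whence a bound on the
  maximum over all blocks of level \<open>i\<close> that decays geometrically in \<open>m - i\<close>.
\<close>

lemma csum_block_le:
  assumes "i \<le> m" "l < 2 ^ (m - i)"
  shows "\<bar>csum 0 (r ^ i) (block i l) \<omega>\<bar> \<le> r ^ m * sqrt (energy m \<omega>) * (1 / rho) ^ (m - i)"
    and "\<bar>csum (r ^ (i - 1)) (r ^ i) (block i l) \<omega>\<bar> \<le> r ^ m * sqrt (energy m \<omega>) * (1 / rho) ^ (m - i)"
proof -
  let ?u = "csum 0 (r ^ i) (block i l) \<omega>" and ?w = "csum (r ^ (i - 1)) (r ^ i) (block i l) \<omega>"
  have rho: "0 < rho" using rho_gt_1 by simp
  have "rho ^ (2 * (m - i)) / r ^ (2 * m) * (?u\<^sup>2 + ?w\<^sup>2)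
      \<le> rho ^ (2 * (m - i)) / r ^ (2 * m) *
    (\<Sum>l<2 ^ (m - i). (csum 0 (r ^ i) (block i l) \<omega>)\<^sup>2
                       + (csum (r ^ (i - 1)) (r ^ i) (block i l) \<omega>)\<^sup>2)"
    using assms rho by (intro mult_left_mono member_le_sum) auto
  also have "\<dots> \<le> energy m \<omega>"
    unfolding energy_def using assms rho
    by (intro member_le_sum[where f = "\<lambda>i. rho ^ (2 * (m - i)) / r ^ (2 * m) *
    (\<Sum>l<2 ^ (m - i). (csum 0 (r ^ i) (block i l) \<omega>)\<^sup>2
                       + (csum (r ^ (i - 1)) (r ^ i) (block i l) \<omega>)\<^sup>2)"] mult_nonneg_nonneg sum_nonneg) auto
  finally have le: "rho ^ (2 * (m - i)) / r ^ (2 * m) * (?u\<^sup>2 + ?w\<^sup>2) \<le> energy m \<omega>" .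
  have main: "\<bar>x\<bar> \<le> r ^ m * sqrt (energy m \<omega>) * (1 / rho) ^ (m - i)" if x: "x\<^sup>2 \<le> ?u\<^sup>2 + ?w\<^sup>2" for x
  proof -
    have "(rho ^ (m - i) / r ^ m * \<bar>x\<bar>)\<^sup>2 = rho ^ (2 * (m - i)) / r ^ (2 * m) * x\<^sup>2"
      by (simp add: power_mult_distrib power_divide power_mult[symmetric] mult.commute)
    also have "\<dots> \<le> rho ^ (2 * (m - i)) / r ^ (2 * m) * (?u\<^sup>2 + ?w\<^sup>2)"
      using x rho by (intro mult_left_mono) auto
    finally have "rho ^ (m - i) / r ^ m * \<bar>x\<bar> \<le> sqrt (energy m \<omega>)"
      using le by (intro real_le_rsqrt) simp
    then show ?thesis using rho by (simp add: field_simps power_divide)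
  qed
  show "\<bar>?u\<bar> \<le> r ^ m * sqrt (energy m \<omega>) * (1 / rho) ^ (m - i)" by (rule main) simp
  show "\<bar>?w\<bar> \<le> r ^ m * sqrt (energy m \<omega>) * (1 / rho) ^ (m - i)" by (rule main) simp
qed

text \<open>
  The means \<open>2 ^ Suc s * (r ^ Suc s * q s)\<close> lost by chaining, summed over the levels \<open>s \<le> m\<close> and
  divided by \<open>r ^ m\<close>. The level \<open>s = m\<close>, which chaining does not reach, completes the sum to a
  convolution.
\<close>

definition drift :: "nat \<Rightarrow> real" where
  "drift m = (\<Sum>s\<le>m. (2 * r * (2 ^ s * q s)) * (1 / r) ^ (m - s))"

lemma drift_tendsto_0: "drift \<longlonglongrightarrow> 0"
proof -
  have "summable drift"
    unfolding drift_def using tail_summable q_nonneg r_gt_1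
    by (intro convolution_summable summable_mult summable_geometric) auto
  then show ?thesis by (rule summable_LIMSEQ_zero)
qed

lemma truncated_sum_le:
  assumes n: "n < 2 ^ m"
  shows "\<bar>csum 0 (r ^ m) {..<n} \<omega>\<bar> \<le> r ^ m * (2 / (1 - 1 / rho) * sqrt (energy m \<omega>) + drift m)"
proof -
  define E where "E i = r ^ m * sqrt (energy m \<omega>) * (1 / rho) ^ (m - i)" for i
  have E_nonneg: "0 \<le> E i" for i
    using energy_nonneg rho_gt_1 by (simp add: E_def)
  have "\<bar>csum 0 (r ^ m) {n div 2 ^ m * 2 ^ m ..< n} \<omega>\<bar>
      \<le> (\<Sum>s<m. E s + E (Suc s) + 2 ^ Suc s * (r ^ Suc s * q s))"
    unfolding E_def using csum_block_le(1)[of _ m _ \<omega>] csum_block_le(2)[of "Suc _" m _ \<omega>]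
    by (intro chaining[OF n]) (auto simp del: power_Suc)
  \<comment> \<open>at the top level the chain ends at \<open>0\<close>\<close>
  also have "{n div 2 ^ m * 2 ^ m ..< n} = {..<n}"
    using n by auto
  also have "(\<Sum>s<m. E s + E (Suc s) + 2 ^ Suc s * (r ^ Suc s * q s))
      = (\<Sum>s<m. E s) + (\<Sum>s<m. E (Suc s)) + (\<Sum>s<m. 2 ^ Suc s * (r ^ Suc s * q s))"
    by (simp add: sum.distrib)
  also have "(\<Sum>s<m. E s) \<le> (\<Sum>s\<le>m. E s)"
    using E_nonneg by (intro sum_mono2) auto
  also have "(\<Sum>s<m. E (Suc s)) \<le> (\<Sum>s\<le>m. E s)"
  proof -
    have "(\<Sum>s<m. E (Suc s)) = sum E (Suc ` {..<m})" by (simp add: sum.reindex)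
    also have "\<dots> \<le> (\<Sum>s\<le>m. E s)" using E_nonneg by (intro sum_mono2) auto
    finally show ?thesis .
  qed
  also have "(\<Sum>s<m. 2 ^ Suc s * (r ^ Suc s * q s)) \<le> r ^ m * drift m"
  proof -
    have "2 ^ Suc s * (r ^ Suc s * q s) = r ^ m * (2 * r * (2 ^ s * q s) * (1 / r) ^ (m - s))" if "s < m" for s
    proof -
      obtain d where "m = s + d" using \<open>s < m\<close> less_imp_add_positive by blast
      then show ?thesis by (simp add: power_add power_divide field_simps)
    qed
    then have "(\<Sum>s<m. 2 ^ Suc s * (r ^ Suc s * q s))
        = (\<Sum>s<m. r ^ m * (2 * r * (2 ^ s * q s) * (1 / r) ^ (m - s)))"
      by (intro sum.cong) auto
    also have "\<dots> \<le> (\<Sum>s\<le>m. r ^ m * (2 * r * (2 ^ s * q s) * (1 / r) ^ (m - s)))"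
      using q_nonneg by (intro sum_mono2) auto
    finally show ?thesis by (simp add: drift_def sum_distrib_left)
  qed
  also have "(\<Sum>s\<le>m. E s) \<le> r ^ m * (1 / (1 - 1 / rho) * sqrt (energy m \<omega>))"
  proof -
    have "(\<Sum>s\<le>m. (1 / rho) ^ (m - s)) = (\<Sum>s\<le>m. (1 / rho) ^ s)"
      using sum.nat_diff_reindex[of "\<lambda>s. (1 / rho) ^ s" "Suc m"] by (simp add: lessThan_Suc_atMost)
    also have "\<dots> \<le> (\<Sum>s. (1 / rho) ^ s)"
      using rho_gt_1 by (intro sum_le_suminf summable_geometric) auto
    also have "\<dots> = 1 / (1 - 1 / rho)"
      using rho_gt_1 by (intro suminf_geometric) auto
    finally have "r ^ m * sqrt (energy m \<omega>) * (\<Sum>s\<le>m. (1 / rho) ^ (m - s))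
        \<le> r ^ m * sqrt (energy m \<omega>) * (1 / (1 - 1 / rho))"
      using energy_nonneg by (intro mult_left_mono) auto
    then show ?thesis by (simp add: E_def sum_distrib_left mult_ac)
  qed
  finally show ?thesis by (simp add: algebra_simps)
qed

text \<open>
  A bound, uniform in \<open>k\<close>, for the expectation of \<open>max (Z k - r ^ m) 0\<close>.
\<close>

definition excess :: "nat \<Rightarrow> real" where
  "excess m = (\<Sum>j. r ^ Suc (m + j) * q (m + j))"

lemma excess_terms_summable: "summable (\<lambda>j. r ^ Suc (m + j) * q (m + j))"
proof (rule summable_comparison_test'[where N = 0])
  show "summable (\<lambda>j. 2 * (2 ^ (m + j) * q (m + j)))"
    using summable_ignore_initial_segment[OF tail_summable, of m]
    by (intro summable_mult) (simp add: add.commute)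
  fix j
  have "r ^ Suc (m + j) \<le> 2 ^ Suc (m + j)" using r_less_2 by (intro power_mono) auto
  from mult_right_mono[OF this q_nonneg[of "m + j"]]
  show "norm (r ^ Suc (m + j) * q (m + j)) \<le> 2 * (2 ^ (m + j) * q (m + j))"
    using q_nonneg by (simp add: abs_mult mult_ac)
qed

lemma excess_nonneg: "0 \<le> excess m"
  unfolding excess_def using q_nonneg by (intro suminf_nonneg excess_terms_summable) auto

text \<open>
  Here \<open>r < 2\<close>, that is \<open>p > 1\<close>, is used: in terms of \<open>2 ^ j * q j\<close> the tail of the series is
  damped by the powers of \<open>r / 2\<close>.
\<close>

lemma excess_summable: "summable (\<lambda>m. 2 ^ m / r ^ m * excess m)"
proof -
  have "summable (\<lambda>m. r * (\<Sum>j. (r / 2) ^ j * (2 ^ (m + j) * q (m + j))))"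
    using r_less_2 q_nonneg
    by (intro summable_mult suminf_shifted_convolution_summable[OF tail_summable]) auto
  moreover have "r * (\<Sum>j. (r / 2) ^ j * (2 ^ (m + j) * q (m + j))) = 2 ^ m / r ^ m * excess m" for m
  proof -
    have *: "r ^ Suc (m + j) * q (m + j) = r ^ m / 2 ^ m * r * ((r / 2) ^ j * (2 ^ (m + j) * q (m + j)))" for j
      by (simp add: power_add power_divide)
    have "summable (\<lambda>j. (r / 2) ^ j * (2 ^ (m + j) * q (m + j)))"
      using excess_terms_summable[of m] unfolding * summable_cmult_iff by auto
    then show ?thesis
      unfolding excess_def * by (subst suminf_mult) auto
  qed
  ultimately show ?thesis by simp
qed

text \<open>
  The first-order analogue of the bound for squares: each level \<open>r ^ (m + j)\<close> passed by \<open>z\<close> adds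
  the next level to the bound. At every \<open>z\<close> only finitely many terms differ from \<open>0\<close>.
\<close>

lemma overshoot_le_suminf:
  assumes "0 \<le> z"
  shows "ennreal (max (z - r ^ m) 0) \<le> (\<Sum>j. ennreal (r ^ Suc (m + j) * indicator {z. r ^ (m + j) < z} z))"
proof -
  obtain J where J: "z < r ^ J" using real_arch_pow[OF r_gt_1] by blast
  also have "r ^ J \<le> r ^ (m + J)" using r_gt_1 by (intro power_increasing) auto
  finally have zJ: "z < r ^ (m + J)" .
  have "max (min z (r ^ (m + J)) - r ^ m) 0 \<le> (\<Sum>j<J. r ^ Suc (m + j) * indicator {z. r ^ (m + j) < z} z)"
  proof (induction J)
    case 0
    then show ?case by simp
  next
    case (Suc J)
    show ?case
    proof (cases "r ^ (m + J) < z")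
      case True
      have "max (min z (r ^ (m + Suc J)) - r ^ m) 0 \<le> r ^ Suc (m + J)"
      proof -
        have "min z (r ^ (m + Suc J)) \<le> r ^ Suc (m + J)" by simp
        then show ?thesis
          using r_pow_pos[of "Suc (m + J)"] r_pow_pos[of m] unfolding max_def by (smt (verit))
      qed
      also have "\<dots> \<le> (\<Sum>j<Suc J. r ^ Suc (m + j) * indicator {z. r ^ (m + j) < z} z)"
        using True by (auto intro!: sum_nonneg)
      finally show ?thesis .
    next
      case False
      then have "min z (r ^ (m + Suc J)) = min z (r ^ (m + J))"
        using r_pow_le_Suc[of "m + J"] by (simp add: min_def del: power_Suc)
      then show ?thesis using Suc False by (simp del: power_Suc)
    qed
  qed
  then have "ennreal (max (z - r ^ m) 0)
      \<le> ennreal (\<Sum>j<J. r ^ Suc (m + j) * indicator {z. r ^ (m + j) < z} z)"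
    using zJ by (intro ennreal_leI) simp
  also have "\<dots> = (\<Sum>j<J. ennreal (r ^ Suc (m + j) * indicator {z. r ^ (m + j) < z} z))"
    by (intro sum_ennreal[symmetric]) auto
  also have "\<dots> \<le> (\<Sum>j. ennreal (r ^ Suc (m + j) * indicator {z. r ^ (m + j) < z} z))"
    by (intro sum_le_suminf) auto
  finally show ?thesis .
qed

lemma
  shows overshoot_integrable: "integrable M (\<lambda>\<omega>. max (Z k \<omega> - r ^ m) 0)"
    and expectation_overshoot_le: "expectation (\<lambda>\<omega>. max (Z k \<omega> - r ^ m) 0) \<le> excess m"
proof -
  have "(\<integral>\<^sup>+\<omega>. ennreal (max (Z k \<omega> - r ^ m) 0) \<partial>M)
      \<le> (\<integral>\<^sup>+\<omega>. (\<Sum>j. ennreal (r ^ Suc (m + j)) * indicator {\<omega> \<in> space M. r ^ (m + j) < Z k \<omega>} \<omega>) \<partial>M)"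
  proof (rule nn_integral_mono)
    fix \<omega> assume "\<omega> \<in> space M"
    then have "(\<Sum>j. ennreal (r ^ Suc (m + j) * indicator {z. r ^ (m + j) < z} (Z k \<omega>)))
        = (\<Sum>j. ennreal (r ^ Suc (m + j)) * indicator {\<omega> \<in> space M. r ^ (m + j) < Z k \<omega>} \<omega>)"
      by (intro suminf_cong) (auto simp: indicator_def)
    then show "ennreal (max (Z k \<omega> - r ^ m) 0)
      \<le> (\<Sum>j. ennreal (r ^ Suc (m + j)) * indicator {\<omega> \<in> space M. r ^ (m + j) < Z k \<omega>} \<omega>)"
      using overshoot_le_suminf[OF Z_nonneg[of k \<omega>], of m] by simp
  qed
  also have "\<dots> = (\<Sum>j. ennreal (r ^ Suc (m + j)) * emeasure M {\<omega> \<in> space M. r ^ (m + j) < Z k \<omega>})"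
    by (subst nn_integral_suminf) (auto simp: nn_integral_cmult_indicator simp del: power_Suc)
  also have "\<dots> \<le> (\<Sum>j. ennreal (r ^ Suc (m + j) * q (m + j)))"
    using tail_le r_pow_pos[of "Suc _"] q_nonneg
    by (intro suminf_le) (auto simp: emeasure_eq_measure ennreal_mult[symmetric] simp del: power_Suc intro!: ennreal_leI mult_left_mono less_imp_le)
  also have "\<dots> = ennreal (excess m)"
    unfolding excess_def using q_nonneg by (intro suminf_ennreal2 excess_terms_summable) auto
  finally have le: "(\<integral>\<^sup>+\<omega>. ennreal (max (Z k \<omega> - r ^ m) 0) \<partial>M) \<le> ennreal (excess m)" .
  show int: "integrable M (\<lambda>\<omega>. max (Z k \<omega> - r ^ m) 0)"
    by (intro integrableI_nonneg) (use le in \<open>auto intro: le_less_trans\<close>)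
  show "expectation (\<lambda>\<omega>. max (Z k \<omega> - r ^ m) 0) \<le> excess m"
    using le excess_nonneg by (subst (asm) nn_integral_eq_integral[OF int]) auto
qed

lemma layer_plus_overshoot: "Z k \<omega> = layer 0 (r ^ m) (Z k \<omega>) + max (Z k \<omega> - r ^ m) 0"
  using Z_nonneg[of k \<omega>] r_pow_pos[of m] by (auto simp: layer_def max_def min_def simp del: r_pow_pos)

lemma Z_integrable: "integrable M (Z k)"
proof -
  have "integrable M (\<lambda>\<omega>. layer 0 (r ^ 0) (Z k \<omega>) + max (Z k \<omega> - r ^ 0) 0)"
    by (intro Bochner_Integration.integrable_add overshoot_integrable) auto
  then show ?thesis unfolding layer_plus_overshoot[symmetric] .
qed

definition overshoot :: "nat \<Rightarrow> 'a \<Rightarrow> real" where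
  "overshoot m \<omega> = (\<Sum>k<2 ^ m. max (Z k \<omega> - r ^ m) 0) / r ^ m"

lemma overshoot_sum_integrable: "integrable M (overshoot m)"
  unfolding overshoot_def by (intro integrable_divide Bochner_Integration.integrable_sum overshoot_integrable)

lemma overshoot_nonneg: "0 \<le> overshoot m \<omega>"
  unfolding overshoot_def by (intro divide_nonneg_nonneg sum_nonneg) auto

lemma expectation_overshoot_summable: "summable (\<lambda>m. expectation (overshoot m))"
proof (rule summable_comparison_test'[where N = 0, OF excess_summable])
  fix m
  have "expectation (overshoot m) = (\<Sum>k<2 ^ m. expectation (\<lambda>\<omega>. max (Z k \<omega> - r ^ m) 0)) / r ^ m"
    unfolding overshoot_def using overshoot_integrable by simp
  also have "\<dots> \<le> (\<Sum>k<(2::nat) ^ m. excess m) / r ^ m"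
    by (intro divide_right_mono sum_mono expectation_overshoot_le) auto
  finally show "norm (expectation (overshoot m)) \<le> 2 ^ m / r ^ m * excess m"
    using overshoot_nonneg by (simp add: Bochner_Integration.integral_nonneg)
qed

lemma sum_centered_le:
  assumes n: "n < 2 ^ m"
  shows "\<bar>\<Sum>k<n. Z k \<omega> - expectation (Z k)\<bar>
    \<le> \<bar>csum 0 (r ^ m) {..<n} \<omega>\<bar> + r ^ m * (overshoot m \<omega> + expectation (overshoot m))"
proof -
  let ?o = "\<lambda>k \<omega>. max (Z k \<omega> - r ^ m) 0"
  have "expectation (Z k) = mean 0 (r ^ m) k + expectation (?o k)" for k
  proof -
    have "expectation (Z k) = expectation (\<lambda>\<omega>. layer 0 (r ^ m) (Z k \<omega>) + ?o k \<omega>)"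
      unfolding layer_plus_overshoot[symmetric] ..
    then show ?thesis
      unfolding mean_def using overshoot_integrable by simp
  qed
  then have "(\<Sum>k<n. Z k \<omega> - expectation (Z k))
      = (\<Sum>k<n. layer 0 (r ^ m) (Z k \<omega>) + ?o k \<omega> - (mean 0 (r ^ m) k + expectation (?o k)))"
    using layer_plus_overshoot[of _ \<omega> m] by simp
  also have "\<dots> = csum 0 (r ^ m) {..<n} \<omega> + (\<Sum>k<n. ?o k \<omega>) - (\<Sum>k<n. expectation (?o k))"
    by (simp add: csum_def sum.distrib sum_subtractf)
  finally have eq: "(\<Sum>k<n. Z k \<omega> - expectation (Z k))
      = csum 0 (r ^ m) {..<n} \<omega> + (\<Sum>k<n. ?o k \<omega>) - (\<Sum>k<n. expectation (?o k))" .
  have "(\<Sum>k<n. ?o k \<omega>) \<le> (\<Sum>k<2 ^ m. ?o k \<omega>)"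
    using n by (intro sum_mono2) auto
  then have 1: "(\<Sum>k<n. ?o k \<omega>) \<le> r ^ m * overshoot m \<omega>"
    by (simp add: overshoot_def)
  have "(\<Sum>k<n. expectation (?o k)) \<le> (\<Sum>k<2 ^ m. expectation (?o k))"
    using n by (intro sum_mono2) (auto intro!: Bochner_Integration.integral_nonneg)
  then have 2: "(\<Sum>k<n. expectation (?o k)) \<le> r ^ m * expectation (overshoot m)"
    unfolding overshoot_def using overshoot_integrable by simp
  have 3: "0 \<le> (\<Sum>k<n. ?o k \<omega>)" "0 \<le> (\<Sum>k<n. expectation (?o k))"
    by (auto intro!: sum_nonneg Bochner_Integration.integral_nonneg)
  show ?thesis
    unfolding eq distrib_left using 1 2 3 by linarith
qed

text \<open>
  The error \<open>\<eta>\<close> has three sources: block sums (\<open>energy\<close>), the means lost by chaining (\<open>drift\<close>), and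
  the values above the level \<open>r ^ m\<close> (\<open>overshoot\<close>), the last of which counts once pathwise and once
  for the centring.
\<close>

theorem dyadic_strong_law:
  "AE \<omega> in M. \<exists>\<eta>. \<eta> \<longlonglongrightarrow> 0 \<and>
    (\<forall>m n. n < 2 ^ m \<longrightarrow> \<bar>\<Sum>k<n. Z k \<omega> - expectation (Z k)\<bar> \<le> r ^ m * \<eta> m)"
proof -
  have "AE \<omega> in M. (\<lambda>m. energy m \<omega>) \<longlonglongrightarrow> 0"
    by (rule AE_tendsto_zero_of_summable_integral)
       (fact energy_integrable energy_nonneg expectation_energy_summable)+
  moreover have "AE \<omega> in M. (\<lambda>m. overshoot m \<omega>) \<longlonglongrightarrow> 0"
    by (rule AE_tendsto_zero_of_summable_integral)
       (fact overshoot_sum_integrable overshoot_nonneg expectation_overshoot_summable)+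
  ultimately show ?thesis
  proof eventually_elim
    case (elim \<omega>)
    define \<eta> where "\<eta> m = 2 / (1 - 1 / rho) * sqrt (energy m \<omega>) + drift m
      + (overshoot m \<omega> + expectation (overshoot m))" for m
    have "(\<lambda>m. expectation (overshoot m)) \<longlonglongrightarrow> 0"
      using expectation_overshoot_summable by (rule summable_LIMSEQ_zero)
    then have "\<eta> \<longlonglongrightarrow> 2 / (1 - 1 / rho) * sqrt 0 + 0 + (0 + 0)"
      unfolding \<eta>_def using elim drift_tendsto_0 by (intro tendsto_intros)
    moreover have "\<bar>\<Sum>k<n. Z k \<omega> - expectation (Z k)\<bar> \<le> r ^ m * \<eta> m" if "n < 2 ^ m" for m n
      using sum_centered_le[OF that, of \<omega>] truncated_sum_le[OF that, of \<omega>]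
      unfolding \<eta>_def by (simp add: distrib_left)
    ultimately show ?case by auto
  qed
qed

end

section \<open>Dyadic tails and dyadic partial sums\<close>

text \<open>
  The powers of two below \<open>y\<close> form a geometric sum, dominated by twice its largest term.
\<close>

lemma sum_dyadic_indicator_le:
  fixes y :: real
  assumes "0 \<le> y"
  shows "(\<Sum>j<J. 2 ^ j * indicator {y. 2 ^ j < y} y) \<le> 2 * y"
proof (induction J)
  case 0
  then show ?case using assms by simp
next
  case (Suc J)
  show ?case
  proof (cases "2 ^ J < y")
    case True
    have "(\<Sum>j<Suc J. 2 ^ j * indicator {y. 2 ^ j < y} y) \<le> (\<Sum>j<Suc J. 2 ^ j :: real)"
      by (intro sum_mono) (auto simp: indicator_def)
    also have "\<dots> = 2 ^ Suc J - 1" by (induction J) auto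
    also have "\<dots> \<le> 2 * y" using True by simp
    finally show ?thesis .
  next
    case False
    then show ?thesis using Suc by simp
  qed
qed

lemma two_powr_power: "(2 powr x) ^ m = (2 ^ m :: real) powr x"
proof -
  have *: "(2::real) ^ m = 2 powr real m" by (rule powr_realpow[symmetric]) simp
  show ?thesis unfolding * powr_powr by (subst powr_power) (simp_all add: mult.commute)
qed

lemma powr_inverse_power_less_iff:
  fixes p t :: real
  assumes "0 < p" "0 \<le> t"
  shows "(2 powr (1 / p)) ^ j < t \<longleftrightarrow> 2 ^ j < t powr p"
proof -
  let ?b = "(2 ^ j :: real) powr (1 / p)"
  have "?b < t \<longleftrightarrow> ?b powr p < t powr p"
    using assms powr_less_mono2[of p ?b t] powr_mono2[of p t ?b] by (auto simp: not_le[symmetric])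
  moreover have "?b powr p = 2 ^ j"
    using assms by (simp add: powr_powr)
  ultimately show ?thesis by (simp add: two_powr_power)
qed

lemma (in prob_space) dyadic_tail_summable:
  fixes Y :: "'a \<Rightarrow> real"
  assumes [measurable]: "Y \<in> borel_measurable M" and p: "0 < p"
    and int: "integrable M (\<lambda>\<omega>. \<bar>Y \<omega>\<bar> powr p)"
  shows "summable (\<lambda>j. 2 ^ j * prob {\<omega> \<in> space M. (2 powr (1 / p)) ^ j < \<bar>Y \<omega>\<bar>})"
proof (rule summableI_nonneg_bounded)
  fix J
  let ?A = "\<lambda>j. {\<omega> \<in> space M. 2 ^ j < \<bar>Y \<omega>\<bar> powr p}"
  have ind: "integrable M (indicator (?A j) :: 'a \<Rightarrow> real)" for j
    by (rule integrable_real_indicator) (auto simp: emeasure_eq_measure)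
  have "(\<Sum>j<J. 2 ^ j * prob {\<omega> \<in> space M. (2 powr (1 / p)) ^ j < \<bar>Y \<omega>\<bar>})
      = (\<Sum>j<J. 2 ^ j * prob (?A j))"
    using p by (simp add: powr_inverse_power_less_iff)
  also have "\<dots> = (\<Sum>j<J. expectation (\<lambda>\<omega>. 2 ^ j * indicator (?A j) \<omega>))"
    by (simp add: Int_absorb2 subset_eq)
  also have "\<dots> = expectation (\<lambda>\<omega>. \<Sum>j<J. 2 ^ j * indicator (?A j) \<omega>)"
    by (intro Bochner_Integration.integral_sum[symmetric] integrable_mult_right ind)
  also have "\<dots> \<le> expectation (\<lambda>\<omega>. 2 * \<bar>Y \<omega>\<bar> powr p)"
  proof (rule integral_mono)
    show "integrable M (\<lambda>\<omega>. \<Sum>j<J. 2 ^ j * indicator (?A j) \<omega> :: real)"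
      by (intro Bochner_Integration.integrable_sum integrable_mult_right ind)
    fix \<omega> assume "\<omega> \<in> space M"
    then show "(\<Sum>j<J. 2 ^ j * indicator (?A j) \<omega>) \<le> 2 * \<bar>Y \<omega>\<bar> powr p"
      using sum_dyadic_indicator_le[of "\<bar>Y \<omega>\<bar> powr p" J] by (simp add: indicator_def)
  qed (use int in auto)
  finally show "(\<Sum>j<J. 2 ^ j * prob {\<omega> \<in> space M. (2 powr (1 / p)) ^ j < \<bar>Y \<omega>\<bar>})
      \<le> expectation (\<lambda>\<omega>. 2 * \<bar>Y \<omega>\<bar> powr p)" .
qed auto

text \<open>
  If \<open>2 ^ m \<le> n < 2 ^ (m + 1)\<close>, the normalization at \<open>n\<close> and the dyadic one at \<open>m + 1\<close> differ at most
  by the factor \<open>2 powr (1 / p)\<close>.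
\<close>

lemma tendsto_0_of_dyadic_bound:
  fixes s \<eta> :: "nat \<Rightarrow> real"
  assumes p: "0 < p" and \<eta>: "\<eta> \<longlonglongrightarrow> 0"
    and le: "\<And>m n. n < 2 ^ m \<Longrightarrow> \<bar>s n\<bar> \<le> (2 powr (1 / p)) ^ m * \<eta> m"
  shows "(\<lambda>n. 1 / real n powr (1 / p) * s n) \<longlonglongrightarrow> 0"
proof (rule LIMSEQ_I)
  fix e :: real assume e: "0 < e"
  define r where "r = (2 :: real) powr (1 / p)"
  have r: "0 < r" by (simp add: r_def)
  obtain m0 where m0: "\<And>m. m0 \<le> m \<Longrightarrow> \<bar>\<eta> m\<bar> < e / r"
    using LIMSEQ_D[OF \<eta>, of "e / r"] e r by auto
  have "norm (1 / real n powr (1 / p) * s n - 0) < e" if n: "2 ^ m0 \<le> n" for n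
  proof -
    have "n > 0" using n by (metis gr0I le_zero_eq power_not_zero zero_neq_numeral)
    then obtain m where m: "2 ^ m \<le> n" "n < 2 ^ (m + 1)"
      using ex_power_ivl1[of 2 n] by auto
    have "(2::nat) ^ m0 < 2 ^ (m + 1)" using n m by linarith
    then have "m0 \<le> Suc m" using power_less_imp_less_exp[of "2::nat" m0 "m + 1"] by simp
    have "r ^ m = (2 ^ m) powr (1 / p)"
      unfolding r_def by (rule two_powr_power)
    also have "\<dots> \<le> real n powr (1 / p)"
      using m p by (intro powr_mono2) (auto simp: numeral_power_le_of_nat_cancel_iff)
    finally have rn: "r ^ m \<le> real n powr (1 / p)" .
    have "\<bar>s n\<bar> \<le> r ^ Suc m * \<eta> (Suc m)"
      using le[of n "Suc m"] m by (simp add: r_def)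
    also have "\<dots> \<le> r ^ Suc m * \<bar>\<eta> (Suc m)\<bar>"
      using r by (intro mult_left_mono) auto
    also have "\<dots> < r ^ Suc m * (e / r)"
      using m0[OF \<open>m0 \<le> Suc m\<close>] r by (intro mult_strict_left_mono) auto
    also have "\<dots> = r ^ m * e" using r by simp
    also have "\<dots> \<le> real n powr (1 / p) * e"
      using rn e by (intro mult_right_mono) auto
    finally show ?thesis
      using \<open>n > 0\<close> by (simp add: abs_mult divide_less_eq mult.commute)
  qed
  then show "\<exists>no. \<forall>n\<ge>no. norm (1 / real n powr (1 / p) * s n - 0) < e" by blast
qed

section \<open>The truncated covariance series of a pairwise PQD sequence\<close>

lemma ennreal_sum_le_infsum:
  fixes f :: "'b \<Rightarrow> ennreal"
  assumes "finite F" "F \<subseteq> A"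
  shows "sum f F \<le> infsum f A"
proof -
  have "sum f F = infsum f F" using assms(1) by simp
  also have "\<dots> \<le> infsum f A"
    by (rule infsum_mono_neutral) (use assms(2) in \<open>auto intro: nonneg_summable_on_complete\<close>)
  finally show ?thesis .
qed

context prob_space
begin

lemma trunc_cov_eq_covariance_layer:
  fixes U V :: "'a \<Rightarrow> real"
  assumes "U \<in> borel_measurable M" "V \<in> borel_measurable M" "0 \<le> L"
  shows "trunc_cov M U V L
    = covariance M (\<lambda>\<omega>. layer (- L) L (U \<omega>)) (\<lambda>\<omega>. layer (- L) L (V \<omega>))"
  unfolding trunc_cov_def trunc_eq_layer[OF assms(3)]
  using assms by (intro covariance_shift) auto

context
  fixes X :: "nat \<Rightarrow> 'a \<Rightarrow> real"
  assumes X_measurable: "\<And>n. n \<ge> 1 \<Longrightarrow> X n \<in> borel_measurable M"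
    and X_PQD: "pairwise_PQD M X"
begin

lemma Suc_measurable [measurable]: "X (Suc k) \<in> borel_measurable M"
  using X_measurable by simp

lemma PQD_Suc:
  assumes "k \<noteq> l"
  shows "prob {\<omega> \<in> space M. X (Suc k) \<omega> \<le> x} * prob {\<omega> \<in> space M. X (Suc l) \<omega> \<le> y}
      \<le> prob {\<omega> \<in> space M. X (Suc k) \<omega> \<le> x \<and> X (Suc l) \<omega> \<le> y}"
proof -
  have "1 \<le> Suc k" "1 \<le> Suc l" "Suc k \<noteq> Suc l" using assms by auto
  then show ?thesis
    using X_PQD[unfolded pairwise_PQD_def, rule_format, of "Suc k" "Suc l" x y] by linarith
qed

lemma covariance_layer_le_trunc_cov:
  assumes "k \<noteq> l" "- L \<le> a" "a \<le> b" "b \<le> L"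
  shows "covariance M (\<lambda>\<omega>. layer a b (X (Suc k) \<omega>)) (\<lambda>\<omega>. layer a b (X (Suc l) \<omega>))
    \<le> trunc_cov M (X (Suc k)) (X (Suc l)) L"
proof -
  have "0 \<le> L" using assms by linarith
  show ?thesis
    unfolding trunc_cov_eq_covariance_layer[OF Suc_measurable Suc_measurable \<open>0 \<le> L\<close>]
    by (rule covariance_layer_mono[OF Suc_measurable Suc_measurable PQD_Suc]) (use assms in auto)
qed

lemma trunc_cov_nonneg:
  assumes "k \<noteq> l" "0 \<le> L"
  shows "0 \<le> trunc_cov M (X (Suc k)) (X (Suc l)) L"
  unfolding trunc_cov_eq_covariance_layer[OF Suc_measurable Suc_measurable assms(2)]
  by (rule covariance_layer_nonneg[OF Suc_measurable Suc_measurable PQD_Suc]) (use assms in auto)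

lemma trunc_cov_mono:
  assumes "k \<noteq> l" "0 \<le> L" "L \<le> L'"
  shows "trunc_cov M (X (Suc k)) (X (Suc l)) L \<le> trunc_cov M (X (Suc k)) (X (Suc l)) L'"
  unfolding trunc_cov_eq_covariance_layer[OF Suc_measurable Suc_measurable assms(2)]
  by (rule covariance_layer_le_trunc_cov) (use assms in auto)

text \<open>
  Let \<open>N = 2 ^ m\<close>. Each of the \<open>N\<close> terms of the inner series with \<open>N \<le> n < 2 * N\<close> is at least
  \<open>(2 * N) powr (- 1 - 2 / \<alpha>) * G(N powr (1 / p))\<close>, because \<open>G\<close> increases with the truncation level. For indices
  up to \<open>N\<close> all these terms occur, so the pair contributes at least a constant times
  \<open>N powr (- 2 / \<alpha>) * G(N powr (1 / p))\<close>.
\<close>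

lemma trunc_cov_sum_le:
  fixes p \<alpha> :: real
  assumes p: "0 < p" and \<alpha>: "0 < \<alpha>" and fin: "trunc_cov_series M X p \<alpha> < \<infinity>"
  shows "(\<Sum>(k, l)\<in>{(k, l). k < l \<and> l < 2 ^ m}. trunc_cov M (X (Suc k)) (X (Suc l)) ((2 powr (1 / p)) ^ m))
    \<le> 2 powr (1 + 2 / \<alpha>) * enn2real (trunc_cov_series M X p \<alpha>) * (2 powr (2 / \<alpha>)) ^ m"
proof -
  define N where "N = (2::nat) ^ m"
  define c where "c = real (2 * N) powr (- 1 - 2 / \<alpha>)"
  let ?P = "{(k, l). k < l \<and> l < 2 ^ m} :: (nat \<times> nat) set"
  let ?t = "\<lambda>i j n. real n powr (- 1 - 2 / \<alpha>) * trunc_cov M (X i) (X j) (real n powr (1 / p))"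
  let ?G = "\<lambda>k l. trunc_cov M (X (Suc k)) (X (Suc l)) ((2 powr (1 / p)) ^ m)"
  let ?s = "map_prod Suc Suc"
  have N: "0 < N" by (simp add: N_def)
  have finP: "finite ?P"
    by (rule finite_subset[of _ "{..<2 ^ m} \<times> {..<2 ^ m}"]) auto
  have rm: "(2 powr (1 / p)) ^ m = real N powr (1 / p)"
    by (simp add: N_def two_powr_power)
  have t_nonneg: "0 \<le> ?t (Suc k) (Suc l) n" if "k < l" for k l n
    using that by (intro mult_nonneg_nonneg trunc_cov_nonneg) auto
  have low: "ennreal (N * c * ?G k l) \<le> (\<Sum>\<^sub>\<infinity>n\<in>{Suc l..}. ennreal (?t (Suc k) (Suc l) n))"
    if kl: "k < l" "l < 2 ^ m" for k l
  proof -
    have "N * c * ?G k l = (\<Sum>n\<in>{N..<2 * N}. c * ?G k l)" by simp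
    also have "\<dots> \<le> (\<Sum>n\<in>{N..<2 * N}. ?t (Suc k) (Suc l) n)"
    proof (rule sum_mono)
      fix n assume n: "n \<in> {N..<2 * N}"
      have "c \<le> real n powr (- 1 - 2 / \<alpha>)"
      proof -
        have "0 \<le> 2 / \<alpha>" using \<alpha> by simp
        then have "- 1 - 2 / \<alpha> \<le> 0" by linarith
        then show ?thesis unfolding c_def by (rule powr_mono2') (use n N in auto)
      qed
      moreover have "?G k l \<le> trunc_cov M (X (Suc k)) (X (Suc l)) (real n powr (1 / p))"
        unfolding rm using kl n N p by (intro trunc_cov_mono powr_mono2) auto
      ultimately show "c * ?G k l \<le> ?t (Suc k) (Suc l) n"
        using kl by (intro mult_mono) (auto intro!: trunc_cov_nonneg simp: c_def)
    qed
    finally have "ennreal (N * c * ?G k l) \<le> ennreal (\<Sum>n\<in>{N..<2 * N}. ?t (Suc k) (Suc l) n)"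
      by (rule ennreal_leI)
    also have "\<dots> = (\<Sum>n\<in>{N..<2 * N}. ennreal (?t (Suc k) (Suc l) n))"
      using kl t_nonneg by (intro sum_ennreal[symmetric]) auto
    also have "\<dots> \<le> (\<Sum>\<^sub>\<infinity>n\<in>{Suc l..}. ennreal (?t (Suc k) (Suc l) n))"
      using kl by (intro ennreal_sum_le_infsum) (auto simp: N_def)
    finally show ?thesis .
  qed
  have "ennreal (\<Sum>(k, l)\<in>?P. N * c * ?G k l) = (\<Sum>(k, l)\<in>?P. ennreal (N * c * ?G k l))"
    by (subst sum_ennreal[symmetric])
       (auto simp: c_def split_beta intro!: mult_nonneg_nonneg trunc_cov_nonneg)
  also have "\<dots> \<le> (\<Sum>(k, l)\<in>?P. \<Sum>\<^sub>\<infinity>n\<in>{Suc l..}. ennreal (?t (Suc k) (Suc l) n))"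
    using low by (intro sum_mono) auto
  also have "\<dots> = (\<Sum>(i, j)\<in>?s ` ?P. \<Sum>\<^sub>\<infinity>n\<in>{j..}. ennreal (?t i j n))"
    by (subst sum.reindex) (auto simp: inj_on_def split_beta)
  also have "\<dots> \<le> trunc_cov_series M X p \<alpha>"
    unfolding trunc_cov_series_def using finP by (intro ennreal_sum_le_infsum) auto
  also have "\<dots> = ennreal (enn2real (trunc_cov_series M X p \<alpha>))"
    using fin by simp
  finally have "(\<Sum>(k, l)\<in>?P. N * c * ?G k l) \<le> enn2real (trunc_cov_series M X p \<alpha>)"
    by (subst (asm) ennreal_le_iff) auto
  then have le: "N * c * (\<Sum>(k, l)\<in>?P. ?G k l) \<le> enn2real (trunc_cov_series M X p \<alpha>)"
    by (simp add: sum_distrib_left split_beta)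
  have Nc: "N * c * (2 powr (1 + 2 / \<alpha>) * (2 powr (2 / \<alpha>)) ^ m) = 1"
  proof -
    let ?e = "- 1 - 2 / \<alpha>"
    have c: "c = 2 powr ?e * real N powr ?e"
      by (simp add: c_def powr_mult)
    have "real N * (real N powr ?e * real N powr (2 / \<alpha>)) = 1"
      using N by (simp add: powr_add[symmetric] powr_minus)
    moreover have "2 powr ?e * 2 powr (1 + 2 / \<alpha>) = (1::real)"
      by (simp add: powr_add[symmetric])
    moreover have "N * c * (2 powr (1 + 2 / \<alpha>) * (2 powr (2 / \<alpha>)) ^ m)
      = (2 powr ?e * 2 powr (1 + 2 / \<alpha>)) * (real N * (real N powr ?e * real N powr (2 / \<alpha>)))"
      unfolding c two_powr_power by (simp add: N_def mult_ac)
    ultimately show ?thesis by (simp only: mult_1_left)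
  qed
  have "(\<Sum>(k, l)\<in>?P. ?G k l)
      = N * c * (\<Sum>(k, l)\<in>?P. ?G k l) * (2 powr (1 + 2 / \<alpha>) * (2 powr (2 / \<alpha>)) ^ m)"
    using Nc by (simp only: mult.assoc mult.left_commute[of _ "\<Sum>(k, l)\<in>?P. ?G k l"] mult_1_right)
  also have "\<dots> \<le> enn2real (trunc_cov_series M X p \<alpha>) * (2 powr (1 + 2 / \<alpha>) * (2 powr (2 / \<alpha>)) ^ m)"
    using le by (intro mult_right_mono) auto
  finally show ?thesis by (simp add: mult_ac)
qed

lemma trunc_cov_offdiag_sum_le:
  fixes p \<alpha> :: real
  assumes p: "0 < p" and \<alpha>: "0 < \<alpha>" and fin: "trunc_cov_series M X p \<alpha> < \<infinity>"
  shows "(\<Sum>(k, l)\<in>{(k, l). k < 2 ^ m \<and> l < 2 ^ m \<and> k \<noteq> l}.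
      trunc_cov M (X (Suc k)) (X (Suc l)) ((2 powr (1 / p)) ^ m))
    \<le> 2 * (2 powr (1 + 2 / \<alpha>) * enn2real (trunc_cov_series M X p \<alpha>)) * (2 powr (2 / \<alpha>)) ^ m"
proof -
  let ?G = "\<lambda>(k, l). trunc_cov M (X (Suc k)) (X (Suc l)) ((2 powr (1 / p)) ^ m)"
  let ?P = "{(k, l). k < l \<and> l < 2 ^ m} :: (nat \<times> nat) set"
  have finP: "finite ?P"
    by (rule finite_subset[of _ "{..<2 ^ m} \<times> {..<2 ^ m}"]) auto
  have "{(k, l). k < 2 ^ m \<and> l < 2 ^ m \<and> k \<noteq> l} = ?P \<union> prod.swap ` ?P"
    by (auto simp: image_iff)
  then have "sum ?G {(k, l). k < 2 ^ m \<and> l < 2 ^ m \<and> k \<noteq> l} = sum ?G ?P + sum ?G (prod.swap ` ?P)"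
    using finP by (simp only:) (intro sum.union_disjoint, auto)
  also have "sum ?G (prod.swap ` ?P) = sum ?G ?P"
    by (subst sum.reindex) (auto simp: trunc_cov_def covariance_commute split_beta intro!: sum.cong)
  finally show ?thesis
    using trunc_cov_sum_le[OF assms, of m] by simp
qed

text \<open>
  For levels \<open>0 \<le> a \<le> b\<close>, a layer of the positive part is the layer of \<open>X\<^sub>k\<close> itself, and a layer of
  the negative part is a constant minus the layer of \<open>X\<^sub>k\<close> from \<open>- b\<close> to \<open>- a\<close>; reflecting both
  variables preserves the covariance.
\<close>

lemma layered_sequence_parts:
  fixes Y :: "'a \<Rightarrow> real" and p \<alpha> :: real
  assumes p: "1 < p" "p < 2" "p < \<alpha>" "\<alpha> < 2" and Y [measurable]: "Y \<in> borel_measurable M"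
    and dom: "stochastically_dominated M X Y"
    and int: "integrable M (\<lambda>\<omega>. \<bar>Y \<omega>\<bar> powr p)" and fin: "trunc_cov_series M X p \<alpha> < \<infinity>"
  obtains q K where
    "layered_sequence M (\<lambda>k \<omega>. max (X (Suc k) \<omega>) 0) q (2 powr (1 / p)) (2 powr (2 / \<alpha>)) K"
    "layered_sequence M (\<lambda>k \<omega>. max (- X (Suc k) \<omega>) 0) q (2 powr (1 / p)) (2 powr (2 / \<alpha>)) K"
proof -
  define r where "r = (2::real) powr (1 / p)"
  define \<beta> where "\<beta> = (2::real) powr (2 / \<alpha>)"
  define K where "K = 2 * (2 powr (1 + 2 / \<alpha>) * enn2real (trunc_cov_series M X p \<alpha>))"
  obtain C where C: "0 < C" and dom: "\<And>t. 0 < t \<Longrightarrow>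
      (SUP n\<in>{1..}. prob {\<omega> \<in> space M. t < \<bar>X n \<omega>\<bar>}) \<le> C * prob {\<omega> \<in> space M. t < \<bar>Y \<omega>\<bar>}"
    using dom unfolding stochastically_dominated_def by auto
  define q where "q j = C * prob {\<omega> \<in> space M. r ^ j < \<bar>Y \<omega>\<bar>}" for j
  have r: "1 < r" "r < 2"
  proof -
    show "1 < r" unfolding r_def using p by simp
    have "r < 2 powr 1" unfolding r_def using p by (intro powr_less_mono) auto
    then show "r < 2" by simp
  qed
  have beta: "2 \<le> \<beta>" "\<beta> < r\<^sup>2"
  proof -
    have "2 powr 1 \<le> \<beta>" unfolding \<beta>_def using p by (intro powr_mono) auto
    then show "2 \<le> \<beta>" by simp
    have "\<beta> < 2 powr (2 / p)"
      unfolding \<beta>_def using p by (intro powr_less_mono divide_strict_left_mono) auto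
    also have "2 powr (2 / p) = r\<^sup>2" unfolding r_def power2_eq_square powr_add[symmetric] by simp
    finally show "\<beta> < r\<^sup>2" .
  qed
  have q_sum: "summable (\<lambda>j. 2 ^ j * q j)"
    using summable_mult[OF dyadic_tail_summable[OF Y _ int], of C] p
    by (simp add: q_def r_def mult_ac)
  have tail: "prob {\<omega> \<in> space M. r ^ j < \<bar>X (Suc k) \<omega>\<bar>} \<le> q j" for k j
  proof -
    have "prob {\<omega> \<in> space M. r ^ j < \<bar>X (Suc k) \<omega>\<bar>} \<le> (SUP n\<in>{1..}. prob {\<omega> \<in> space M. r ^ j < \<bar>X n \<omega>\<bar>})"
      by (intro cSUP_upper bdd_aboveI2[where M = 1]) auto
    also have "\<dots> \<le> q j"
      unfolding q_def using r by (intro dom) auto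
    finally show ?thesis .
  qed
  have parts: "layered_sequence M Z q r \<beta> K"
    if Z [measurable]: "\<And>k. Z k \<in> borel_measurable M"
      and Z_nonneg: "\<And>k \<omega>. 0 \<le> Z k \<omega>" and Z_le: "\<And>k \<omega>. Z k \<omega> \<le> \<bar>X (Suc k) \<omega>\<bar>"
      and cov: "\<And>k l a b. 0 \<le> a \<Longrightarrow> a \<le> b \<Longrightarrow> \<exists>c d. - b \<le> c \<and> c \<le> d \<and> d \<le> b \<and>
        covariance M (\<lambda>\<omega>. layer a b (Z k \<omega>)) (\<lambda>\<omega>. layer a b (Z l \<omega>))
          = covariance M (\<lambda>\<omega>. layer c d (X (Suc k) \<omega>)) (\<lambda>\<omega>. layer c d (X (Suc l) \<omega>))" for Z
  proof unfold_locales
    fix k j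
    have "prob {\<omega> \<in> space M. r ^ j < Z k \<omega>} \<le> prob {\<omega> \<in> space M. r ^ j < \<bar>X (Suc k) \<omega>\<bar>}"
      using Z_le by (intro finite_measure_mono) (auto intro: less_le_trans)
    then show "prob {\<omega> \<in> space M. r ^ j < Z k \<omega>} \<le> q j"
      using tail[of j k] by linarith
  next
    fix k l :: nat and a b :: real
    assume "k \<noteq> l" "0 \<le> a" "a \<le> b"
    then obtain c d where "c \<le> d" and eq: "covariance M (\<lambda>\<omega>. layer a b (Z k \<omega>)) (\<lambda>\<omega>. layer a b (Z l \<omega>))
        = covariance M (\<lambda>\<omega>. layer c d (X (Suc k) \<omega>)) (\<lambda>\<omega>. layer c d (X (Suc l) \<omega>))"
      using cov[of a b k l] by auto
    show "0 \<le> covariance M (\<lambda>\<omega>. layer a b (Z k \<omega>)) (\<lambda>\<omega>. layer a b (Z l \<omega>))"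
      unfolding eq
      by (rule covariance_layer_nonneg[OF Suc_measurable Suc_measurable PQD_Suc[OF \<open>k \<noteq> l\<close>]]) fact+
  next
    fix m :: nat and a b :: real
    assume ab: "0 \<le> a" "a \<le> b" "b \<le> r ^ m"
    have "(\<Sum>(k, l)\<in>{(k, l). k < 2 ^ m \<and> l < 2 ^ m \<and> k \<noteq> l}.
          covariance M (\<lambda>\<omega>. layer a b (Z k \<omega>)) (\<lambda>\<omega>. layer a b (Z l \<omega>)))
        \<le> (\<Sum>(k, l)\<in>{(k, l). k < 2 ^ m \<and> l < 2 ^ m \<and> k \<noteq> l}. trunc_cov M (X (Suc k)) (X (Suc l)) (r ^ m))"
    proof (rule sum_mono, clarify)
      fix k l :: nat assume "k \<noteq> l"
      moreover obtain c d where "- b \<le> c" "c \<le> d" "d \<le> b" and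
        "covariance M (\<lambda>\<omega>. layer a b (Z k \<omega>)) (\<lambda>\<omega>. layer a b (Z l \<omega>))
          = covariance M (\<lambda>\<omega>. layer c d (X (Suc k) \<omega>)) (\<lambda>\<omega>. layer c d (X (Suc l) \<omega>))"
        using cov[OF ab(1,2), of k l] by auto
      ultimately show "covariance M (\<lambda>\<omega>. layer a b (Z k \<omega>)) (\<lambda>\<omega>. layer a b (Z l \<omega>))
          \<le> trunc_cov M (X (Suc k)) (X (Suc l)) (r ^ m)"
        using covariance_layer_le_trunc_cov[of k l "r ^ m" c d] ab by simp
    qed
    also have "\<dots> \<le> K * \<beta> ^ m"
      using trunc_cov_offdiag_sum_le[of p \<alpha> m] p fin by (simp add: r_def \<beta>_def K_def)
    finally show "(\<Sum>(k, l)\<in>{(k, l). k < 2 ^ m \<and> l < 2 ^ m \<and> k \<noteq> l}.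
          covariance M (\<lambda>\<omega>. layer a b (Z k \<omega>)) (\<lambda>\<omega>. layer a b (Z l \<omega>))) \<le> K * \<beta> ^ m" .
  qed (use Z Z_nonneg r beta q_sum in auto)
  show thesis
  proof (rule that[folded r_def \<beta>_def])
    show "layered_sequence M (\<lambda>k \<omega>. max (X (Suc k) \<omega>) 0) q r \<beta> K"
    proof (rule parts)
      fix k l and a b :: real assume "0 \<le> a" "a \<le> b"
      then show "\<exists>c d. - b \<le> c \<and> c \<le> d \<and> d \<le> b \<and>
        covariance M (\<lambda>\<omega>. layer a b (max (X (Suc k) \<omega>) 0)) (\<lambda>\<omega>. layer a b (max (X (Suc l) \<omega>) 0))
          = covariance M (\<lambda>\<omega>. layer c d (X (Suc k) \<omega>)) (\<lambda>\<omega>. layer c d (X (Suc l) \<omega>))"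
        by (intro exI[of _ a] exI[of _ b]) (simp add: layer_pos_part)
    qed auto
    show "layered_sequence M (\<lambda>k \<omega>. max (- X (Suc k) \<omega>) 0) q r \<beta> K"
    proof (rule parts)
      fix k l and a b :: real assume "0 \<le> a" "a \<le> b"
      then show "\<exists>c d. - b \<le> c \<and> c \<le> d \<and> d \<le> b \<and>
        covariance M (\<lambda>\<omega>. layer a b (max (- X (Suc k) \<omega>) 0)) (\<lambda>\<omega>. layer a b (max (- X (Suc l) \<omega>) 0))
          = covariance M (\<lambda>\<omega>. layer c d (X (Suc k) \<omega>)) (\<lambda>\<omega>. layer c d (X (Suc l) \<omega>))"
        by (intro exI[of _ "- b"] exI[of _ "- a"])
           (simp add: layer_pos_part layer_uminus covariance_reflect)
    qed auto
  qed
qed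

end
end

section \<open>The Marcinkiewicz-Zygmund strong law\<close>

theorem corollary4:
  fixes M :: "'a measure" and X :: "nat \<Rightarrow> 'a \<Rightarrow> real" and Y :: "'a \<Rightarrow> real"
    and p \<alpha> :: real
  assumes "prob_space M"
    and "1 < p" and "p < 2"
    and "\<And>n. n \<ge> 1 \<Longrightarrow> X n \<in> borel_measurable M"
    and "pairwise_PQD M X"
    and "Y \<in> borel_measurable M"
    and "stochastically_dominated M X Y"
    and "integrable M (\<lambda>\<omega>. \<bar>Y \<omega>\<bar> powr p)"
    and "p < \<alpha>" and "\<alpha> < 2"
    and "trunc_cov_series M X p \<alpha> < \<infinity>"
  shows "AE \<omega> in M. (\<lambda>n. 1 / real n powr (1 / p) *
           (\<Sum>k=1..n. X k \<omega> - (LINT \<omega>'|M. X k \<omega>'))) \<longlonglongrightarrow> 0"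
proof -
  interpret prob_space M by fact
  obtain q K where
    pos: "layered_sequence M (\<lambda>k \<omega>. max (X (Suc k) \<omega>) 0) q (2 powr (1 / p)) (2 powr (2 / \<alpha>)) K" and
    neg: "layered_sequence M (\<lambda>k \<omega>. max (- X (Suc k) \<omega>) 0) q (2 powr (1 / p)) (2 powr (2 / \<alpha>)) K"
    using layered_sequence_parts[of X p \<alpha> Y, OF assms(4) assms(5,2,3,9,10,6,7,8,11)] by metis
  interpret pos: layered_sequence M "\<lambda>k \<omega>. max (X (Suc k) \<omega>) 0" q "2 powr (1 / p)" "2 powr (2 / \<alpha>)" K
    by (fact pos)
  interpret neg: layered_sequence M "\<lambda>k \<omega>. max (- X (Suc k) \<omega>) 0" q "2 powr (1 / p)" "2 powr (2 / \<alpha>)" K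
    by (fact neg)
  have p: "0 < p" using assms(2) by simp
  have split: "X k \<omega> - expectation (X k)
      = (max (X k \<omega>) 0 - expectation (\<lambda>\<omega>. max (X k \<omega>) 0))
        - (max (- X k \<omega>) 0 - expectation (\<lambda>\<omega>. max (- X k \<omega>) 0))" if k1: "k \<ge> 1" for k \<omega>
  proof -
    obtain j where k: "k = Suc j" using k1 by (cases k) auto
    have x: "max (X k \<omega>) 0 - max (- X k \<omega>) 0 = X k \<omega>" for \<omega>
      by (simp add: max_def)
    have "expectation (\<lambda>\<omega>. max (X k \<omega>) 0 - max (- X k \<omega>) 0)
        = expectation (\<lambda>\<omega>. max (X k \<omega>) 0) - expectation (\<lambda>\<omega>. max (- X k \<omega>) 0)"
      using pos.Z_integrable[of j] neg.Z_integrable[of j]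
      unfolding k by (rule Bochner_Integration.integral_diff)
    then have E: "expectation (X k)
        = expectation (\<lambda>\<omega>. max (X k \<omega>) 0) - expectation (\<lambda>\<omega>. max (- X k \<omega>) 0)"
      by (simp only: x)
    have "u - v = (a - a') - (b - b')" if "v = a' - b'" "a - b = u" for u v a a' b b' :: real
      using that by simp
    from this[OF E x] show ?thesis .
  qed
  from pos.dyadic_strong_law neg.dyadic_strong_law show ?thesis
  proof eventually_elim
    case (elim \<omega>)
    let ?s = "\<lambda>n. \<Sum>k<n. max (X (Suc k) \<omega>) 0 - expectation (\<lambda>\<omega>. max (X (Suc k) \<omega>) 0)"
    let ?t = "\<lambda>n. \<Sum>k<n. max (- X (Suc k) \<omega>) 0 - expectation (\<lambda>\<omega>. max (- X (Suc k) \<omega>) 0)"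
    have "(\<lambda>n. 1 / real n powr (1 / p) * ?s n) \<longlonglongrightarrow> 0"
      by (rule exE[OF elim(1)], elim conjE, rule tendsto_0_of_dyadic_bound[OF p], assumption, simp only:)
    moreover have "(\<lambda>n. 1 / real n powr (1 / p) * ?t n) \<longlonglongrightarrow> 0"
      by (rule exE[OF elim(2)], elim conjE, rule tendsto_0_of_dyadic_bound[OF p], assumption, simp only:)
    ultimately have "(\<lambda>n. 1 / real n powr (1 / p) * ?s n - 1 / real n powr (1 / p) * ?t n) \<longlonglongrightarrow> 0 - 0"
      by (rule tendsto_diff)
    moreover have "(\<Sum>k=1..n. X k \<omega> - expectation (X k)) = ?s n - ?t n" for n
    proof -
      have "(\<Sum>k=1..n. X k \<omega> - expectation (X k)) = (\<Sum>k<n. X (Suc k) \<omega> - expectation (X (Suc k)))"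
        by (rule sum.reindex_bij_witness[of _ Suc "\<lambda>k. k - 1"]) auto
      also have "\<dots> = ?s n - ?t n"
        unfolding sum_subtractf[symmetric] by (intro sum.cong refl split) auto
      finally show ?thesis .
    qed
    ultimately show ?case
      by (simp only: right_diff_distrib diff_zero)
  qed
qed

end
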